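(* Every $3$-spider admits a tournament anti-Sidorenko orientation. That is, for all integers $a,b,c\ge 1$, the edges of the $(a,b,c)$-spider can be oriented so that the resulting oriented graph is tournament anti-Sidorenko.
   Context: An oriented graph $\vec{H}$ is a pair $(V(\vec{H}),A(\vec{H}))$ with (finite) vertex set $V(\vec H)$ and arc set $A(\vec{H})\subseteq V(\vec{H})\times V(\vec{H})$ containing no self-loops and at most one arc between any pair of distinct vertices. Write $v(\vec H)=|V(\vec H)|$ and $a(\vec H)=|A(\vec H)|$. A tournament is an oriented graph with exactly one arc between every pair of distinct vertices. A homomorphism $f:\vec H\to\vec G$ is a function $f:V(\vec H)\to V(\vec G)$ such that $(f(u),f(v))\in A(\vec G)$ for all $(u,v)\in A(\vec H)$; $\hom(\vec H,\vec G)$ is the number of homomorphisms and $t(\vec H,\vec G)=\hom(\vec H,\vec G)/v(\vec G)^{v(\vec H)}$. An oriented graph $\vec H$ is tournament anti-Sidorenko if $t(\vec H,\vec T)\le (1/2)^{a(\vec H)}$ for every tournament $\vec T$. For integers $a_1,\dots,a_k\ge 1$, the $(a_1,\dots,a_k)$-spider, or simply a $k$-spider, is the undirected graph obtained by taking disjoint paths of lengths $a_1,\dots,a_k$ (length meaning number of edges) and identifying all of the paths on one of their endpoints. An orientation of an undirected graph is an oriented graph obtained by choosing one direction for each edge. *)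

theory Defs
  imports Complex_Main "HOL-Library.FuncSet" "Graph_Theory.Pair_Digraph"
begin

locale oriented_graph = pair_digraph G for G :: "'a pair_pre_digraph" +
  assumes asym_arcs: "asym (parcs G)"

locale tournament = oriented_graph G for G :: "'a pair_pre_digraph" +
  assumes total_arcs: "total_on (pverts G) (parcs G)"

text \<open>Homomorphisms are extensional functions, so that they can be counted.\<close>

definition homs :: "'a pair_pre_digraph \<Rightarrow> 'b pair_pre_digraph \<Rightarrow> ('a \<Rightarrow> 'b) set" where
  "homs H G = {f \<in> pverts H \<rightarrow>\<^sub>E pverts G. \<forall>(u, v) \<in> parcs H. (f u, f v) \<in> parcs G}"

definition hom_density :: "'a pair_pre_digraph \<Rightarrow> 'b pair_pre_digraph \<Rightarrow> real" where
  "hom_density H G = real (card (homs H G)) / real (card (pverts G)) ^ card (pverts H)"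

text \<open>The tournaments range over those with natural-number vertices; since tournaments are
  finite and \<open>hom_density\<close> is invariant under isomorphism, this covers all of them
  (\<open>tournament_anti_SidorenkoD\<close> below). The empty tournament is harmless: it
  satisfies the inequality for every \<open>H\<close>.\<close>

definition tournament_anti_Sidorenko :: "'a pair_pre_digraph \<Rightarrow> bool" where
  "tournament_anti_Sidorenko H \<longleftrightarrow> oriented_graph H \<and>
     (\<forall>T :: nat pair_pre_digraph. tournament T \<longrightarrow> hom_density H T \<le> (1 / 2) ^ card (parcs H))"

text \<open>Undirected graphs are symmetric digraphs (locale \<open>pair_graph\<close>): an edge \<open>{u, v}\<close>
  is the pair of arcs \<open>(u, v)\<close> and \<open>(v, u)\<close>. An orientation keeps exactly one of the two.\<close>

definition is_orientation :: "'a pair_pre_digraph \<Rightarrow> 'a pair_pre_digraph \<Rightarrow> bool" where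
  "is_orientation G H \<longleftrightarrow>
     oriented_graph H \<and> pverts H = pverts G \<and> parcs H \<union> (parcs H)\<inverse> = parcs G"

datatype spider_vertex = Centre | Leg nat nat

text \<open>The \<open>i\<close>-th path has vertices \<open>0, \<dots>, as ! i\<close>; the vertices \<open>0\<close> of all paths are identified.\<close>

definition path_vertex :: "nat \<Rightarrow> nat \<Rightarrow> spider_vertex" where
  "path_vertex i j = (if j = 0 then Centre else Leg i j)"

definition spider :: "nat list \<Rightarrow> spider_vertex pair_pre_digraph" where
  "spider as =
     \<lparr> pverts = {path_vertex i j | i j. i < length as \<and> j \<le> as ! i},
       parcs = (let P = {(path_vertex i j, path_vertex i (Suc j)) | i j. i < length as \<and> j < as ! i}
                in P \<union> P\<inverse>) \<rparr>"

lemma pair_graph_spider: "pair_graph (spider as)"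
proof
  show "finite (pverts (spider as))"
  proof -
    have "pverts (spider as) = (\<Union>i<length as. (\<lambda>j. path_vertex i j) ` {..as ! i})"
      by (auto simp: spider_def)
    then show ?thesis by simp
  qed
  show "finite (parcs (spider as))"
  proof -
    have "{(path_vertex i j, path_vertex i (Suc j)) | i j. i < length as \<and> j < as ! i}
        = (\<Union>i<length as. (\<lambda>j. (path_vertex i j, path_vertex i (Suc j))) ` {..<as ! i})"
      by auto
    then have "finite {(path_vertex i j, path_vertex i (Suc j)) | i j. i < length as \<and> j < as ! i}"
      by simp
    then show ?thesis unfolding spider_def Let_def by simp
  qed
  show "symmetric (with_proj (spider as))"
    by (auto simp: symmetric_def spider_def Let_def sym_def)
next
  fix e assume e: "e \<in> parcs (spider as)"
  have *: "path_vertex i j \<in> pverts (spider as)" if "i < length as" "j \<le> as ! i" for i j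
    using that by (auto simp: spider_def)
  show "fst e \<in> pverts (spider as)" "snd e \<in> pverts (spider as)"
    using e * by (auto simp: spider_def Let_def)
  show "fst e \<noteq> snd e"
    using e by (auto simp: spider_def Let_def path_vertex_def split: if_splits)
qed

lemma tournament_anti_SidorenkoD:
  fixes T :: "'b pair_pre_digraph"
  assumes H: "tournament_anti_Sidorenko H" and "tournament T"
  shows "hom_density H T \<le> (1 / 2) ^ card (parcs H)"
proof -
  interpret H: oriented_graph H using H by (simp add: tournament_anti_Sidorenko_def)
  interpret T: tournament T by fact
  obtain g :: "'b \<Rightarrow> nat" where g: "inj_on g (pverts T)"
    using finite_imp_inj_to_nat_seg[OF T.pair_finite_verts] by blast
  define T' where "T' = \<lparr>pverts = g ` pverts T, parcs = map_prod g g ` parcs T\<rparr>"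
  have arc: "(g u, g v) \<in> parcs T' \<longleftrightarrow> (u, v) \<in> parcs T" if "u \<in> pverts T" "v \<in> pverts T" for u v
    using that g by (auto simp: T'_def dest: T.in_arcsD1 T.in_arcsD2 inj_onD)
  have "tournament T'"
  proof
    show "asym (parcs T')"
    proof (rule asymI)
      fix x y assume "(x, y) \<in> parcs T'"
      then obtain u v where uv: "(u, v) \<in> parcs T" "x = g u" "y = g v" by (auto simp: T'_def)
      then have "u \<in> pverts T" "v \<in> pverts T" by (auto dest: T.in_arcsD1 T.in_arcsD2)
      then show "(y, x) \<notin> parcs T'" using uv arc T.asym_arcs by (auto dest: asymD)
    qed
    show "total_on (pverts T') (parcs T')"
    proof (rule total_onI)
      fix x y assume "x \<in> pverts T'" "y \<in> pverts T'" "x \<noteq> y"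
      then obtain u v where "u \<in> pverts T" "v \<in> pverts T" "x = g u" "y = g v" "u \<noteq> v"
        by (auto simp: T'_def)
      then show "(x, y) \<in> parcs T' \<or> (y, x) \<in> parcs T'"
        using T.total_arcs arc by (auto simp: total_on_def)
    qed
    show "finite (pverts T')" "finite (parcs T')"
      using T.pair_finite_verts T.pair_finite_arcs by (auto simp: T'_def)
    fix e assume "e \<in> parcs T'"
    then obtain u v where uv: "(u, v) \<in> parcs T" "e = (g u, g v)" by (auto simp: T'_def)
    then have V: "u \<in> pverts T" "v \<in> pverts T" by (auto dest: T.in_arcsD1 T.in_arcsD2)
    then show "fst e \<in> pverts T'" "snd e \<in> pverts T'" using uv by (auto simp: T'_def)
    have "u \<noteq> v" using uv T.asym_arcs by (auto dest: asymD)
    then show "fst e \<noteq> snd e" using uv V g by (auto dest: inj_onD)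
  qed
  then have le: "hom_density H T' \<le> (1 / 2) ^ card (parcs H)"
    using H by (simp add: tournament_anti_Sidorenko_def)
  have c: "card (pverts T') = card (pverts T)"
    using g by (simp add: T'_def card_image)
  define \<phi> where "\<phi> f = restrict (g \<circ> f) (pverts H)" for f :: "'a \<Rightarrow> 'b"
  have inj: "inj_on \<phi> (homs H T)"
  proof (rule inj_onI)
    fix f f' assume f: "f \<in> homs H T" and f': "f' \<in> homs H T" and eq: "\<phi> f = \<phi> f'"
    show "f = f'"
    proof (rule PiE_ext[of _ "pverts H" "\<lambda>_. pverts T"])
      fix x assume x: "x \<in> pverts H"
      then have "g (f x) = g (f' x)" using fun_cong[OF eq, of x] by (simp add: \<phi>_def)
      moreover have "f x \<in> pverts T" "f' x \<in> pverts T" using x f f' by (auto simp: homs_def)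
      ultimately show "f x = f' x" using g by (auto dest: inj_onD)
    qed (use f f' in \<open>auto simp: homs_def\<close>)
  qed
  have sub: "\<phi> ` homs H T \<subseteq> homs H T'"
  proof (rule image_subsetI)
    fix f assume "f \<in> homs H T"
    then have f: "f \<in> pverts H \<rightarrow>\<^sub>E pverts T" "\<And>u v. (u, v) \<in> parcs H \<Longrightarrow> (f u, f v) \<in> parcs T"
      by (auto simp: homs_def)
    have "\<phi> f \<in> pverts H \<rightarrow>\<^sub>E pverts T'" using f(1) by (auto simp: \<phi>_def T'_def)
    moreover have "(\<phi> f u, \<phi> f v) \<in> parcs T'" if "(u, v) \<in> parcs H" for u v
      using f(2)[OF that] that H.in_arcsD1 H.in_arcsD2 by (auto simp: \<phi>_def T'_def)
    ultimately show "\<phi> f \<in> homs H T'" by (auto simp: homs_def)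
  qed
  have "finite (homs H T')"
  proof (rule finite_subset)
    show "homs H T' \<subseteq> pverts H \<rightarrow>\<^sub>E pverts T'" by (auto simp: homs_def)
    show "finite (pverts H \<rightarrow>\<^sub>E pverts T')"
      using H.pair_finite_verts T.pair_finite_verts by (intro finite_PiE) (auto simp: T'_def)
  qed
  then have "card (homs H T) \<le> card (homs H T')"
    using card_inj_on_le[OF inj sub] by simp
  then have "hom_density H T \<le> hom_density H T'"
    unfolding hom_density_def c by (intro divide_right_mono) auto
  then show ?thesis using le by simp
qed

end

theory Submission
  imports Defs "HOL-Library.Function_Algebras"
begin

text \<open>
  Write the arc indicator of a tournament as \<open>(1 + s x y) / 2\<close> with a skew-symmetric
  \<open>s\<close>, which overestimates it on the diagonal. Let \<open>J\<close> be averaging over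
  the vertices and \<open>S\<close> the averaging operator with kernel \<open>s\<close>. Adding arcs
  away from the centre at the start of a leg applies \<open>J + S\<close>, and a first arc towards
  the centre applies \<open>J - S\<close>. The legs of the orientation are directed away from the
  centre, except that the first arc of one leg is reversed. With
  \<open>u k = (J + S)\<^sup>k 1\<close> and \<open>e k = J (u k)\<close>, and with the reversed leg
  of length \<open>c\<close>, the density times
  \<open>2\<^sup>a\<^sup>+\<^sup>b\<^sup>+\<^sup>c\<close> is at most the mean of
  \<open>u a \<cdot> u b \<cdot> (J - S) (u (c - 1))\<close>, and this mean has to be at most
  \<open>1\<close>.

  If \<open>b = c\<close>, this holds because the last two factors are \<open>e (c - 1) + x\<close>
  and \<open>e (c - 1) - x\<close>, and all \<open>e k\<close> are at most \<open>1\<close>. The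
  case \<open>a = c\<close> is the same. So let the lengths be distinct and the reversed leg be the
  longest. The two factors still nearly have this form, and the inequality between the geometric and
  the arithmetic mean leads to a bound (\<open>spider_density_le_bound\<close>) in terms of the
  numbers \<open>e k\<close> and the inner products of the centred functions
  \<open>m k = u k - e k\<close>.

  Let \<open>f = S 1\<close> be the scores, \<open>q\<close> the mean of \<open>f\<^sup>2\<close>,
  and \<open>K\<close> the compression of \<open>S\<close> to centred functions. Then
  \<open>e (k + 1) = e k - \<langle>f, m k\<rangle>\<close> and
  \<open>m (k + 1) = e k f + K (m k)\<close>. The operator \<open>K\<close> is skew, and the
  Hilbert-Schmidt norm of \<open>S\<close> shows \<open>- K\<^sup>2 \<le> 1 / 2 - q\<close>
  (\<open>bound_K\<close>). If \<open>q \<le> 1 / 4\<close>, this makes the even part of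
  \<open>m k\<close> a vector \<open>p(- K\<^sup>2) f\<close> with
  \<open>0 \<le> p \<le> e (k - 1)\<close> on \<open>[0, 1 / 2 - q]\<close>, in the strong sense of
  membership in a cone whose inner products are nonnegative (\<open>small_q_induct\<close>,
  \<open>cone_ip_nonneg\<close>). So \<open>e\<close> decreases, but by a factor of at most
  \<open>2\<close> in each step, the inner products of the \<open>m k\<close> are controlled by the
  \<open>e k\<close>, and the bound is at most \<open>1\<close> because the product of the
  \<open>e k\<close> in it falls short of \<open>1\<close> by a multiple of \<open>q\<close> that
  outweighs the other terms (\<open>spider_bound_0_1\<close>, \<open>spider_bound_ge_2\<close>). If
  \<open>q \<ge> 1 / 4\<close>, then \<open>e k \<le> 1 / 2\<close> for \<open>k \<ge> 3\<close>,
  and pointwise bounds on the legs suffice (\<open>spider_density_large_q\<close>); only the lengths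
  \<open>1, 2, 3\<close> are too short for this, and for them the bound is computed for every
  \<open>q\<close> (\<open>spider_bound_0_1_2\<close>).
\<close>

section \<open>Skew operators and positivity\<close>

locale semi_inner =
  fixes ip :: "'v::real_vector \<Rightarrow> 'v \<Rightarrow> real"
  assumes ip_add_left: "ip (u + v) w = ip u w + ip v w"
    and ip_scale_left: "ip (c *\<^sub>R v) w = c * ip v w"
    and ip_commute: "ip v w = ip w v"
    and ip_self_nonneg: "0 \<le> ip v v"
begin

lemma ip_add_right: "ip w (u + v) = ip w u + ip w v"
  using ip_add_left ip_commute by metis

lemma ip_scale_right: "ip w (c *\<^sub>R v) = c * ip w v"
  using ip_scale_left ip_commute by metis

lemma ip_zero_left [simp]: "ip 0 w = 0"
  using ip_scale_left[of 0 0 w] by simp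

lemma ip_zero_right [simp]: "ip w 0 = 0"
  using ip_commute ip_zero_left by metis

lemma ip_minus_left: "ip (- v) w = - ip v w"
  using ip_scale_left[of "-1" v w] by simp

lemma ip_minus_right: "ip w (- v) = - ip w v"
  using ip_commute ip_minus_left by metis

lemma ip_diff_left: "ip (u - v) w = ip u w - ip v w"
  using ip_add_left[of u "- v" w] by (simp add: ip_minus_left)

lemma ip_diff_right: "ip w (u - v) = ip w u - ip w v"
  using ip_commute ip_diff_left by metis

lemmas ip_simps = ip_add_left ip_add_right ip_scale_left ip_scale_right
  ip_minus_left ip_minus_right ip_diff_left ip_diff_right

text \<open>The form may be degenerate, so a null vector needs an argument of its own.\<close>

lemma Cauchy_Schwarz: "(ip v w)\<^sup>2 \<le> ip v v * ip w w"
proof (cases "ip v v = 0")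
  case True
  have "ip v w = 0"
  proof (rule ccontr)
    assume ne: "ip v w \<noteq> 0"
    define t where "t = (ip w w + 1) / (2 * ip v w)"
    have "0 \<le> ip (w - t *\<^sub>R v) (w - t *\<^sub>R v)" by (rule ip_self_nonneg)
    also have "\<dots> = ip w w - 2 * t * ip v w"
      using True by (simp add: ip_simps ip_commute[of w v])
    also have "\<dots> = -1" using ne by (simp add: t_def field_simps)
    finally show False by simp
  qed
  then show ?thesis using True by simp
next
  case False
  then have pos: "0 < ip v v" using ip_self_nonneg[of v] by simp
  have "0 \<le> ip (ip v v *\<^sub>R w - ip v w *\<^sub>R v) (ip v v *\<^sub>R w - ip v w *\<^sub>R v)"
    by (rule ip_self_nonneg)
  also have "\<dots> = ip v v * (ip v v * ip w w - (ip v w)\<^sup>2)"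
    by (simp add: ip_simps ip_commute[of w v] power2_eq_square algebra_simps)
  finally show ?thesis using pos by (simp add: zero_le_mult_iff)
qed

end

text \<open>A skew operator \<open>K\<close> has \<open>- K\<^sup>2\<close> positive semidefinite,
  and \<open>\<nu>\<close> bounds it from above. Both \<open>N = - K\<^sup>2\<close> and
  \<open>M = \<nu> - N\<close> are therefore positive semidefinite, and they commute.\<close>

locale skew_contraction = semi_inner ip for ip :: "'v::real_vector \<Rightarrow> 'v \<Rightarrow> real" +
  fixes K :: "'v \<Rightarrow> 'v" and \<nu> :: real
  assumes linear_K: "linear K"
    and skew_K: "ip (K v) w = - ip v (K w)"
    and bound_K: "ip (K v) (K v) \<le> \<nu> * ip v v"
    and \<nu>_nonneg: "0 \<le> \<nu>"
begin

lemmas K_simps = linear_add[OF linear_K] linear_diff[OF linear_K] linear_scale[OF linear_K]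
  linear_neg[OF linear_K] linear_0[OF linear_K]

definition N :: "'v \<Rightarrow> 'v" where "N v = - K (K v)"
definition M :: "'v \<Rightarrow> 'v" where "M v = \<nu> *\<^sub>R v - N v"

lemma linear_N: "linear N"
  by (rule linearI) (simp_all add: N_def K_simps)

lemmas N_simps = linear_add[OF linear_N] linear_diff[OF linear_N] linear_scale[OF linear_N]
  linear_0[OF linear_N]

lemma ip_N_swap: "ip (N v) w = ip v (N w)"
  by (simp add: N_def skew_K ip_simps)

lemma ip_M_swap: "ip (M v) w = ip v (M w)"
  by (simp add: M_def ip_N_swap ip_simps)

lemma ip_K_K: "ip (K v) (K w) = ip v (N w)"
  by (simp add: N_def skew_K ip_simps)

lemma ip_K_self: "ip v (K v) = 0"
  using skew_K[of v v] ip_commute[of v "K v"] by simp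

lemma N_K: "N (K v) = K (N v)"
  by (simp add: N_def K_simps)

lemma N_M: "N (M v) = M (N v)"
  by (simp add: M_def N_simps)

lemma M_K: "M (K v) = K (M v)"
  by (simp add: M_def K_simps N_K)

lemma M_nonneg: "0 \<le> ip v (M v)"
  using bound_K[of v] by (simp add: ip_K_K M_def ip_simps)

text \<open>Positivity of a product of commuting positive operators, without square roots or a
  spectral theorem: a factor \<open>N\<close> is split as \<open>- K K\<close> with one
  \<open>K\<close> moved to each side, and factors \<open>M\<close> are moved to the two sides in
  pairs, which leaves \<open>1\<close> or \<open>M\<close> in the middle.\<close>

lemma ip_word_nonneg: "0 \<le> ip v ((N ^^ i) ((M ^^ j) v))"
proof (induction i arbitrary: v)
  case 0
  show ?case
  proof (induction j arbitrary: v rule: less_induct)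
    case (less j)
    consider "j = 0" | "j = 1" | l where "j = Suc (Suc l)" by (metis One_nat_def not0_implies_Suc)
    then show ?case
    proof cases
      case 1 then show ?thesis by (simp add: ip_self_nonneg)
    next
      case 2 then show ?thesis by (simp add: M_nonneg)
    next
      case 3
      have "ip v ((M ^^ j) v) = ip (M v) ((M ^^ l) (M v))"
        by (simp add: 3 ip_M_swap funpow_swap1)
      then show ?thesis using less.IH[of l "M v"] 3 by simp
    qed
  qed
next
  case (Suc i)
  have M: "K ((M ^^ j) x) = (M ^^ j) (K x)" for x by (induction j) (simp_all add: M_K[symmetric])
  have N: "K ((N ^^ i) x) = (N ^^ i) (K x)" for x by (induction i) (simp_all add: N_K[symmetric])
  have "ip v ((N ^^ Suc i) ((M ^^ j) v)) = ip (K v) ((N ^^ i) ((M ^^ j) (K v)))"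
    by (simp add: ip_K_K[symmetric] M N)
  then show ?case using Suc.IH by simp
qed

text \<open>The vectors \<open>p(N) f\<close> where the polynomial \<open>p(x)\<close> is a
  nonnegative combination of the products \<open>x\<^sup>i (\<nu> - x)\<^sup>j\<close>. In a
  spectral picture these \<open>p\<close> are nonnegative on the spectrum of \<open>N\<close>, which
  is why inner products in the cone are nonnegative; membership in the cone replaces an estimate of
  polynomials on \<open>[0, \<nu>]\<close>.\<close>

inductive cone :: "'v \<Rightarrow> 'v \<Rightarrow> bool" for f where
  scale: "0 \<le> c \<Longrightarrow> cone f (c *\<^sub>R f)"
| add: "cone f v \<Longrightarrow> cone f w \<Longrightarrow> cone f (v + w)"
| N: "cone f v \<Longrightarrow> cone f (N v)"
| M: "cone f v \<Longrightarrow> cone f (M v)"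

lemma cone_zero: "cone f 0"
  using cone.scale[of 0 f] by simp

lemma cone_ip_nonneg:
  assumes "cone f v" and "cone f w"
  shows "0 \<le> ip v w"
proof -
  have base: "0 \<le> ip ((N ^^ i) ((M ^^ j) f)) v" if "cone f v" for i j v
    using that
  proof (induction arbitrary: i j)
    case (scale c)
    show ?case using mult_nonneg_nonneg[OF scale ip_word_nonneg[of f i j]]
      by (simp add: ip_simps ip_commute)
  next
    case (add v w) then show ?case by (simp add: ip_simps)
  next
    case (N v)
    show ?case using N.IH[of "Suc i" j] by (simp add: ip_N_swap)
  next
    case (M v)
    have "M ((N ^^ i) x) = (N ^^ i) (M x)" for x by (induction i) (simp_all add: N_M[symmetric])
    then show ?case using M.IH[of i "Suc j"] by (simp add: ip_M_swap[symmetric])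
  qed
  show ?thesis using assms
  proof (induction arbitrary: w)
    case (scale c)
    show ?case using mult_nonneg_nonneg[OF scale(1) base[OF scale(2), of 0 0]] by (simp add: ip_simps)
  next
    case (add v v') then show ?case by (simp add: ip_simps)
  next
    case (N v) then show ?case using cone.N by (simp add: ip_N_swap)
  next
    case (M v) then show ?case using cone.M by (simp add: ip_M_swap)
  qed
qed

end

section \<open>The recursion for directed walks\<close>

text \<open>The recursion obeyed by the mean \<open>e k\<close> and the centred part
  \<open>m k\<close> of the number of directed walks of length \<open>k\<close> in a tournament,
  suitably scaled. The equation \<open>\<nu> = 1 / 2 - q\<close> expresses that the more the scores
  \<open>f\<close> vary, the smaller the rest of the tournament kernel is.\<close>

locale walk_recursion = skew_contraction ip K \<nu>
  for ip :: "'v::real_vector \<Rightarrow> 'v \<Rightarrow> real" and K \<nu> +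
  fixes f :: 'v and q :: real and e :: "nat \<Rightarrow> real" and m :: "nat \<Rightarrow> 'v"
  assumes q_def: "q = ip f f"
    and \<nu>_eq: "\<nu> = 1 / 2 - q"
    and e_0: "e 0 = 1" and m_0: "m 0 = 0"
    and e_Suc: "e (Suc k) = e k - ip f (m k)"
    and m_Suc: "m (Suc k) = e k *\<^sub>R f + K (m k)"
begin

text \<open>The part of \<open>m k\<close> that is even in \<open>K\<close>: it is
  \<open>p(N) f\<close> for a polynomial \<open>p\<close>, and the odd part of
  \<open>m (Suc k)\<close> is \<open>K (r k)\<close>.\<close>

fun r :: "nat \<Rightarrow> 'v" where
  "r 0 = 0"
| "r (Suc 0) = f"
| "r (Suc (Suc k)) = e (Suc k) *\<^sub>R f - N (r k)"

lemma m_Suc_r: "m (Suc k) = r (Suc k) + K (r k)"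
proof (induction k)
  case 0 show ?case by (simp add: m_Suc e_0 m_0 K_simps)
next
  case (Suc k)
  then show ?case by (simp add: m_Suc[of "Suc k"] K_simps N_def algebra_simps)
qed

lemma q_nonneg: "0 \<le> q"
  using ip_self_nonneg q_def by simp

lemma q_le: "q \<le> 1 / 2"
  using \<nu>_nonneg \<nu>_eq by simp

text \<open>The even vectors; \<open>K\<close> maps them to odd ones, and the two kinds are
  orthogonal because an odd power of \<open>K\<close> is skew.\<close>

inductive_set N_span :: "'v set" where
  scale: "c *\<^sub>R f \<in> N_span"
| diff: "v \<in> N_span \<Longrightarrow> w \<in> N_span \<Longrightarrow> v - w \<in> N_span"
| N: "v \<in> N_span \<Longrightarrow> N v \<in> N_span"

lemma r_N_span: "r k \<in> N_span"
proof (induction k rule: r.induct)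
  case 1 then show ?case using N_span.scale[of 0] by simp
next
  case 2 then show ?case using N_span.scale[of 1] by simp
next
  case (3 k) then show ?case by (auto intro: N_span.intros)
qed

lemma N_span_orthogonal:
  assumes "v \<in> N_span" and "w \<in> N_span"
  shows "ip v (K w) = 0"
proof -
  have NK: "(N ^^ i) (K x) = K ((N ^^ i) x)" for i x
    by (induction i) (simp_all add: N_K)
  have word: "ip f (K ((N ^^ i) f)) = 0" for i
  proof -
    have "ip x (K ((N ^^ i) x)) = 0" for x
    proof (induction i arbitrary: x)
      case 0 then show ?case by (simp add: ip_K_self)
    next
      case (Suc i)
      have "ip x (K ((N ^^ Suc i) x)) = ip (K x) (K ((N ^^ i) (K x)))"
        by (simp add: N_K[symmetric] NK ip_K_K)
      then show ?case using Suc.IH by simp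
    qed
    then show ?thesis by simp
  qed
  have base: "ip ((N ^^ i) f) (K w) = 0" if "w \<in> N_span" for i w
    using that
  proof (induction arbitrary: i)
    case (scale c)
    have "ip ((N ^^ i) f) (K f) = 0"
      using word[of i] by (simp add: skew_K ip_commute[of "(N ^^ i) f"])
    then show ?case by (simp add: K_simps ip_simps)
  next
    case (diff v w) then show ?case by (simp add: K_simps ip_simps)
  next
    case (N v)
    show ?case using N.IH[of "Suc i"] by (simp add: ip_N_swap N_K)
  qed
  show ?thesis using assms
  proof (induction arbitrary: w)
    case (scale c) then show ?case using base[of w 0] by (simp add: ip_simps)
  next
    case (diff v v') then show ?case by (simp add: ip_simps)
  next
    case (N v) then show ?case using N_span.N by (simp add: ip_N_swap N_K)
  qed
qed

lemma ip_m:
  "ip (m (Suc i)) (m (Suc j)) = ip (r (Suc i)) (r (Suc j)) + ip (r i) (N (r j))"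
proof -
  have "ip (K (r i)) (r (Suc j)) = 0"
    using N_span_orthogonal[OF r_N_span r_N_span] ip_commute by metis
  then show ?thesis
    using N_span_orthogonal[OF r_N_span r_N_span] by (simp add: m_Suc_r ip_simps ip_K_K)
qed

lemma e_Suc_Suc: "e (Suc (Suc k)) = e (Suc k) - ip f (r (Suc k))"
proof -
  have "ip f (K (r k)) = 0"
    using N_span_orthogonal[OF r_N_span[of 1] r_N_span] by simp
  then show ?thesis by (simp add: e_Suc[of "Suc k"] m_Suc_r ip_simps)
qed

lemma e_1: "e (Suc 0) = 1"
  by (simp add: e_Suc e_0 m_0)

lemma e_2: "e (Suc (Suc 0)) = 1 - q"
  by (simp add: e_Suc_Suc e_1 q_def)

lemma e_3: "e (Suc (Suc (Suc 0))) = 1 - 2 * q"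
  by (simp add: e_Suc_Suc[of "Suc 0"] e_2 e_1 ip_simps q_def N_simps)

context
  assumes q_small: "q \<le> 1 / 4"
begin

text \<open>Everything is proved in one induction because the parts depend on each other. If
  \<open>e\<close> loses at most half of its value in each step, then
  \<open>e (l + 2) \<ge> e (l + 1) - q e l \<ge> (1 / 2 - q) e l = \<nu> e l\<close>, and this is
  what keeps \<open>r (l + 3) = e (l + 2) f - N (r (l + 1))\<close> in the cone. Membership of
  \<open>r\<close> and of its complement in the cone in turn bounds the decrease of \<open>e\<close>
  by \<open>q\<close> times an earlier value, and for \<open>q \<le> 1 / 4\<close> this decrease is
  at most one half of the current value.\<close>

lemma small_q_induct:
  "0 < e k \<and> e k / 2 \<le> e (Suc k) \<and> e (Suc k) \<le> e k
    \<and> cone f (r (Suc k)) \<and> cone f (e k *\<^sub>R f - r (Suc k))"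
proof (induction k rule: less_induct)
  case (less k)
  have cf: "cone f f" using cone.scale[of 1 f] by simp
  have step: "e (Suc j) - q * e j \<le> e (Suc (Suc j))" "e (Suc (Suc j)) \<le> e (Suc j)" if "j < k" for j
  proof -
    have "0 \<le> ip f (r (Suc j))" "0 \<le> ip f (e j *\<^sub>R f - r (Suc j))"
      using less[OF that] cf by (auto intro: cone_ip_nonneg)
    then show "e (Suc j) - q * e j \<le> e (Suc (Suc j))" "e (Suc (Suc j)) \<le> e (Suc j)"
      by (simp_all add: e_Suc_Suc ip_simps q_def mult.commute)
  qed
  consider "k = 0" | "k = 1" | l where "k = Suc (Suc l)" by (metis One_nat_def not0_implies_Suc)
  then show ?case
  proof cases
    case 1 then show ?thesis using cf cone_zero by (simp add: e_0 e_1)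
  next
    case 2 then show ?thesis
      using cf cone_zero q_small q_nonneg by (simp add: e_1 e_2 N_simps)
  next
    case 3
    from less[of l] 3 have l: "0 < e l" "e l / 2 \<le> e (Suc l)"
      "cone f (r (Suc l))" "cone f (e l *\<^sub>R f - r (Suc l))" by auto
    from less[of "Suc l"] 3 have l': "0 < e (Suc l)" "e (Suc l) / 2 \<le> e k" by auto
    have ql: "q * e l \<le> 1 / 4 * e l" "q * e (Suc l) \<le> 1 / 4 * e (Suc l)"
      using q_small l(1) l'(1) by (intro mult_right_mono; simp)+
    have "\<nu> * e l \<le> e k"
      using step(1)[of l] l(2) 3 by (simp add: \<nu>_eq algebra_simps)
    then have coeff: "0 \<le> e k - \<nu> * e l" by simp
    \<comment> \<open>Splitting \<open>e k = (e k - \<nu> e l) + \<nu> e l\<close> turns the difference into a sum of cone elements.\<close>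
    have eq: "r (Suc k) = (e k - \<nu> * e l) *\<^sub>R f + (M (e l *\<^sub>R f) + N (e l *\<^sub>R f - r (Suc l)))"
      by (simp add: 3 M_def N_simps algebra_simps)
    have r: "cone f (r (Suc k))"
      unfolding eq using l by (intro cone.add cone.M cone.N cone.scale[OF coeff] l(4)) (auto intro: cone.scale)
    have U: "cone f (e k *\<^sub>R f - r (Suc k))"
      using cone.N[OF l(3)] by (simp add: 3)
    have "e k / 2 \<le> e (Suc k)" "e (Suc k) \<le> e k" "0 < e k"
      using step[of "Suc l"] l' ql(2) 3 by (simp_all only:, linarith+)
    with r U show ?thesis by blast
  qed
qed

lemma e_pos: "0 < e k" and e_half: "e k / 2 \<le> e (Suc k)" and e_dec: "e (Suc k) \<le> e k"
  and cone_r': "cone f (e k *\<^sub>R f - r (Suc k))"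
  using small_q_induct[of k] by auto

lemma cone_r: "cone f (r k)"
  using small_q_induct[of "k - 1"] cone_zero by (cases k) auto

lemma e_antimono: "i \<le> j \<Longrightarrow> e j \<le> e i"
  using e_dec by (rule lift_Suc_antimono_le)

lemma e_le_1: "e k \<le> 1"
  using e_antimono[of 0 k] e_0 by simp

lemma e_drop_le: "e (Suc k) - q * e k \<le> e (Suc (Suc k))"
proof -
  have "0 \<le> ip f (e k *\<^sub>R f - r (Suc k))"
    using cone_ip_nonneg[OF cone.scale cone_r', of 1] by simp
  then show ?thesis by (simp add: e_Suc_Suc ip_simps q_def algebra_simps)
qed

lemma \<nu>_e_le: "\<nu> * e k \<le> e (Suc (Suc k))"
  using e_drop_le[of k] e_half[of k] by (simp add: \<nu>_eq algebra_simps)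

text \<open>As polynomials in \<open>N\<close>, the factors lie between \<open>0\<close> and the
  constants \<open>e i\<close>, \<open>e j\<close>.\<close>

lemma ip_r_le: "ip (r (Suc i)) (r (Suc j)) \<le> q * (e i * e j)"
proof -
  have "0 \<le> ip (e i *\<^sub>R f) (e j *\<^sub>R f - r (Suc j))"
    using cone_ip_nonneg[OF cone.scale cone_r'] e_pos[of i] by simp
  moreover have "0 \<le> ip (e i *\<^sub>R f - r (Suc i)) (r (Suc j))"
    by (rule cone_ip_nonneg[OF cone_r' cone_r])
  ultimately show ?thesis by (simp add: ip_simps q_def algebra_simps)
qed

lemma ip_m_nonneg: "0 \<le> ip (m i) (m j)"
proof (cases "i = 0 \<or> j = 0")
  case False
  then obtain i' j' where "i = Suc i'" "j = Suc j'" by (metis not0_implies_Suc)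
  then show ?thesis
    using cone_ip_nonneg[OF cone_r cone_r] cone_ip_nonneg[OF cone_r cone.N[OF cone_r]]
    by (simp add: ip_m)
qed (auto simp: m_0)

lemma ip_m_le: "ip (m (Suc (Suc i))) (m (Suc (Suc j))) \<le> q * (e (Suc i) * e (Suc j) + \<nu> * (e i * e j))"
proof -
  have "0 \<le> ip (r (Suc i)) (M (r (Suc j)))"
    by (rule cone_ip_nonneg[OF cone_r cone.M[OF cone_r]])
  then have "ip (r (Suc i)) (N (r (Suc j))) \<le> \<nu> * ip (r (Suc i)) (r (Suc j))"
    by (simp add: M_def ip_simps)
  also have "\<dots> \<le> \<nu> * (q * (e i * e j))"
    by (intro mult_left_mono ip_r_le \<nu>_nonneg)
  finally show ?thesis using ip_r_le[of "Suc i" "Suc j"] by (simp add: ip_m algebra_simps)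
qed

lemma ip_m_self_le:
  "ip (m (Suc (Suc k))) (m (Suc (Suc k))) \<le> q * (2 * e (Suc k) + e k) * e (Suc (Suc k))"
proof -
  have "e (Suc k) * e (Suc k) \<le> 2 * e (Suc k) * e (Suc (Suc k))"
    using mult_left_mono[OF e_half[of "Suc k"], of "e (Suc k)"] e_pos[of "Suc k"] by simp
  moreover have "\<nu> * (e k * e k) \<le> e k * e (Suc (Suc k))"
    using mult_left_mono[OF \<nu>_e_le[of k], of "e k"] e_pos[of k] by (simp add: mult_ac)
  ultimately have "e (Suc k) * e (Suc k) + \<nu> * (e k * e k) \<le> (2 * e (Suc k) + e k) * e (Suc (Suc k))"
    by (simp add: algebra_simps)
  from mult_left_mono[OF this q_nonneg] ip_m_le[of k k] show ?thesis by (simp add: mult.assoc)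
qed

end

section \<open>The numerical bound for three legs\<close>

text \<open>An upper bound, by \<open>spider_density_le_bound\<close> below, for the scaled density
  of the spider with legs \<open>Suc \<alpha>\<close>, \<open>Suc \<beta>\<close> and
  \<open>Suc \<gamma>\<close> whose last leg starts with a reversed arc.\<close>

definition spider_bound :: "nat \<Rightarrow> nat \<Rightarrow> nat \<Rightarrow> real" where
  "spider_bound \<alpha> \<beta> \<gamma> =
     e (Suc \<alpha>) * e \<beta> * e \<gamma>
     + ip (m (Suc (Suc \<alpha>))) (e \<beta> *\<^sub>R m \<gamma> - e \<gamma> *\<^sub>R m \<beta>)
     + e \<alpha> / (4 * e \<beta> * e \<gamma>) * ip (e \<gamma> *\<^sub>R m \<beta> - e \<beta> *\<^sub>R m \<gamma>) (e \<gamma> *\<^sub>R m \<beta> - e \<beta> *\<^sub>R m \<gamma>)"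

lemma ip_N_f_le: "ip f (N f) \<le> q / 2 - q\<^sup>2"
proof -
  have "ip f (N f) \<le> \<nu> * q"
    using M_nonneg[of f] by (simp add: M_def ip_simps q_def)
  then show ?thesis by (simp add: \<nu>_eq power2_eq_square algebra_simps)
qed

lemma ip_f_K_f: "ip f (K f) = 0" "ip (K f) f = 0"
  using ip_K_self[of f] ip_commute[of "K f" f] by simp_all

lemma q_square_le: "q\<^sup>2 \<le> q / 2"
  using mult_left_mono[OF q_le q_nonneg] by (simp add: power2_eq_square)

text \<open>The legs \<open>1, 2, 3\<close> are so short that the bound is an explicit polynomial in
  \<open>q\<close> and \<open>\<langle>f, N f\<rangle> \<le> q \<nu>\<close>, up to one
  denominator.\<close>

lemma spider_bound_0_1_2: "spider_bound 0 1 2 \<le> 1"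
proof -
  define k where "k = ip f (N f)"
  have m1: "m (Suc 0) = f" and m2: "m (Suc (Suc 0)) = f + K f"
    by (simp_all add: m_Suc_r e_1 K_simps N_simps)
  have sq: "ip (- (q *\<^sub>R f) - K f) (- (q *\<^sub>R f) - K f) = q\<^sup>2 * q + k"
    by (simp add: ip_simps ip_f_K_f ip_K_K q_def[symmetric] k_def power2_eq_square)
  have eq: "(1 - q) *\<^sub>R f - (f + K f) = - (q *\<^sub>R f) - K f"
    by (simp add: algebra_simps)
  have lin: "ip (f + K f) (f + K f - (1 - q) *\<^sub>R f) = q\<^sup>2 + k"
    by (simp add: ip_simps ip_f_K_f ip_K_K q_def[symmetric] k_def) (simp add: power2_eq_square algebra_simps)
  have bound: "spider_bound 0 1 2 = (1 - q) + (q\<^sup>2 + k) + (q\<^sup>2 * q + k) / (4 * (1 - q))"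
    using sq lin by (simp add: spider_bound_def numeral_2_eq_2 e_0 e_1 e_2 m1 m2 eq)
  have k: "k \<le> q / 2 - q\<^sup>2" unfolding k_def by (rule ip_N_f_le)
  have "q\<^sup>2 * q \<le> q / 2 * q"
    using q_square_le q_nonneg by (rule mult_right_mono)
  then have "q\<^sup>2 * q + k \<le> q / 2 * (1 - q)"
    using k by (simp add: power2_eq_square algebra_simps)
  then have "(q\<^sup>2 * q + k) / (4 * (1 - q)) \<le> q / 8"
    using q_le by (simp add: divide_simps) (simp add: algebra_simps)
  then show ?thesis unfolding bound using k q_nonneg by linarith
qed

context
  assumes q_small: "q \<le> 1 / 4"
begin

text \<open>The mixed term of the last norm is dropped: centred parts have nonnegative inner
  products.\<close>

lemma spider_bound_le_split:
  "spider_bound \<alpha> \<beta> \<gamma> \<le> e (Suc \<alpha>) * e \<beta> * e \<gamma>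
     + (e \<beta> * ip (m (Suc (Suc \<alpha>))) (m \<gamma>) - e \<gamma> * ip (m (Suc (Suc \<alpha>))) (m \<beta>))
     + (e \<gamma> / e \<beta> * ip (m \<beta>) (m \<beta>) + e \<beta> / e \<gamma> * ip (m \<gamma>) (m \<gamma>)) / 4"
proof -
  have pos: "0 < e \<alpha>" "0 < e \<beta>" "0 < e \<gamma>" using e_pos[OF q_small] by auto
  let ?X = "ip (e \<gamma> *\<^sub>R m \<beta> - e \<beta> *\<^sub>R m \<gamma>) (e \<gamma> *\<^sub>R m \<beta> - e \<beta> *\<^sub>R m \<gamma>)"
  have "?X = e \<gamma> * e \<gamma> * ip (m \<beta>) (m \<beta>) + e \<beta> * e \<beta> * ip (m \<gamma>) (m \<gamma>)
      - 2 * (e \<beta> * e \<gamma> * ip (m \<beta>) (m \<gamma>))"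
    by (simp add: ip_simps ip_commute[of "m \<gamma>" "m \<beta>"] algebra_simps)
  moreover have "0 \<le> e \<beta> * e \<gamma> * ip (m \<beta>) (m \<gamma>)"
    using pos ip_m_nonneg[OF q_small] by simp
  ultimately have X: "?X \<le> e \<gamma> * e \<gamma> * ip (m \<beta>) (m \<beta>) + e \<beta> * e \<beta> * ip (m \<gamma>) (m \<gamma>)"
    by linarith
  have "e \<alpha> / (4 * e \<beta> * e \<gamma>) * ?X \<le> 1 / (4 * e \<beta> * e \<gamma>) * ?X"
    using pos e_le_1[OF q_small, of \<alpha>] ip_self_nonneg by (intro mult_right_mono divide_right_mono) auto
  also have "\<dots> \<le> 1 / (4 * e \<beta> * e \<gamma>) * (e \<gamma> * e \<gamma> * ip (m \<beta>) (m \<beta>) + e \<beta> * e \<beta> * ip (m \<gamma>) (m \<gamma>))"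
    using pos X by (intro mult_left_mono) auto
  also have "\<dots> = (e \<gamma> / e \<beta> * ip (m \<beta>) (m \<beta>) + e \<beta> / e \<gamma> * ip (m \<gamma>) (m \<gamma>)) / 4"
    using pos by (simp add: field_simps)
  finally show ?thesis by (simp add: spider_bound_def ip_simps)
qed

lemma ratio_ip_m_le:
  "e \<beta> / e (Suc (Suc k)) * ip (m (Suc (Suc k))) (m (Suc (Suc k))) \<le> e \<beta> * (q * (2 * e (Suc k) + e k))"
proof -
  have "ip (m (Suc (Suc k))) (m (Suc (Suc k))) / e (Suc (Suc k)) \<le> q * (2 * e (Suc k) + e k)"
    using ip_m_self_le[OF q_small, of k] e_pos[OF q_small, of "Suc (Suc k)"] by (simp add: divide_le_eq)
  from mult_left_mono[OF this, of "e \<beta>"] e_pos[OF q_small, of \<beta>] show ?thesis by simp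
qed

lemma e_le_from_3: "3 \<le> \<gamma> \<Longrightarrow> e \<gamma> \<le> 1 - 2 * q"
  using e_antimono[OF q_small, of 3 \<gamma>] e_3 by (simp add: numeral_3_eq_3)

lemma e_le_from_2: "2 \<le> \<gamma> \<Longrightarrow> e \<gamma> \<le> 1 - q"
  using e_antimono[OF q_small, of 2 \<gamma>] e_2 by (simp add: numeral_2_eq_2)

text \<open>The factor \<open>e \<gamma> \<le> 1 - 2 q\<close> gains \<open>2 q\<close>. The inner
  products with \<open>m \<gamma>\<close> and \<open>m 1 = f\<close> nearly cancel and lose at most
  \<open>q / 2\<close>, and the norms lose at most \<open>q\<close>.\<close>

lemma spider_bound_0_1:
  assumes "3 \<le> \<gamma>"
  shows "spider_bound 0 1 \<gamma> \<le> 1"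
proof -
  obtain k where k: "\<gamma> = Suc (Suc k)" "1 \<le> k"
    using assms that[of "\<gamma> - 2"] by simp
  have m1: "m (Suc 0) = f" by (simp add: m_Suc_r K_simps)
  have m2f: "ip (m (Suc (Suc 0))) f = q"
    by (simp add: m_Suc_r e_1 N_simps ip_simps ip_f_K_f q_def)
  have e: "e \<gamma> \<le> 1 - 2 * q" "e (Suc k) \<le> 1 - q" "e k \<le> 1" "0 \<le> e k" "0 < e \<gamma>"
    using e_le_from_3[OF assms] e_le_from_2[of "Suc k"] k e_le_1[OF q_small, of k] e_pos[OF q_small, of k]
      e_pos[OF q_small, of \<gamma>] by auto
  have A: "ip (m (Suc (Suc 0))) (m \<gamma>) \<le> q * (e (Suc k) + \<nu> * e k)"
    using ip_m_le[OF q_small, of 0 k] by (simp add: k e_0 e_1)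
  have "q * (e (Suc k) + \<nu> * e k) \<le> q * (e \<gamma> + q + \<nu>)"
  proof (rule mult_left_mono[OF _ q_nonneg])
    have "e (Suc k) - q * e k \<le> e \<gamma>" using e_drop_le[OF q_small, of k] k by simp
    moreover have "(q + \<nu>) * e k \<le> (q + \<nu>) * 1"
      using e q_nonneg \<nu>_nonneg by (intro mult_left_mono) auto
    ultimately show "e (Suc k) + \<nu> * e k \<le> e \<gamma> + q + \<nu>" by (simp add: algebra_simps)
  qed
  then have B: "q * (e (Suc k) + \<nu> * e k) - e \<gamma> * q \<le> q / 2"
    by (simp add: \<nu>_eq algebra_simps)
  have C: "1 / e \<gamma> * ip (m \<gamma>) (m \<gamma>) \<le> 3 * q"
  proof -
    have "q * (2 * e (Suc k) + e k) \<le> q * 3"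
      using e q_nonneg by (intro mult_left_mono) auto
    then show ?thesis using ratio_ip_m_le[of "Suc 0" k] by (simp add: k e_1)
  qed
  have D: "e \<gamma> * q \<le> q" using e q_nonneg mult_right_mono[of "e \<gamma>" 1 q] by simp
  have "spider_bound 0 1 \<gamma> \<le> e \<gamma> + (ip (m (Suc (Suc 0))) (m \<gamma>) - e \<gamma> * q)
      + (e \<gamma> * q + 1 / e \<gamma> * ip (m \<gamma>) (m \<gamma>)) / 4"
    using spider_bound_le_split[of 0 1 \<gamma>] by (simp add: e_1 m1 m2f q_def[symmetric])
  with A B C D e(1) q_nonneg show ?thesis by argo
qed

text \<open>Here \<open>e \<beta> e \<gamma> \<le> (1 - q) (1 - 2 q)\<close> gains about
  \<open>3 q\<close>. The inner products lose at most \<open>3 q / 2\<close> and the norms at most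
  \<open>9 q / 8\<close>, so that no cancellation is needed.\<close>

lemma spider_bound_ge_2:
  assumes "2 \<le> \<beta>" and "\<beta> \<le> \<gamma>" and "3 \<le> \<gamma>"
  shows "spider_bound \<alpha> \<beta> \<gamma> \<le> 1"
proof -
  obtain j where j: "\<beta> = Suc (Suc j)"
    using assms that[of "\<beta> - 2"] by simp
  obtain k where k: "\<gamma> = Suc (Suc k)" "1 \<le> k"
    using assms that[of "\<gamma> - 2"] by simp
  note pos = less_imp_le[OF e_pos[OF q_small]] and le1 = e_le_1[OF q_small]
  have q1: "0 \<le> 1 - q" using q_le by simp
  have e: "e \<gamma> \<le> 1 - 2 * q" "e (Suc k) \<le> 1 - q" "e \<beta> \<le> 1 - q"
    using e_le_from_3[OF assms(3)] e_le_from_2[of "Suc k"] e_le_from_2[OF assms(1)] k by auto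
  have T: "e (Suc \<alpha>) * e \<beta> * e \<gamma> \<le> 1 * (1 - q) * (1 - 2 * q)"
    using pos le1 e q1 by (intro mult_mono) auto
  have "ip (m (Suc (Suc \<alpha>))) (m \<gamma>) \<le> q * (e (Suc \<alpha>) * e (Suc k) + \<nu> * (e \<alpha> * e k))"
    using ip_m_le[OF q_small, of \<alpha> k] by (simp add: k)
  also have "\<dots> \<le> q * (1 * (1 - q) + \<nu> * (1 * 1))"
    using pos le1 e q1 \<nu>_nonneg q_nonneg by (intro mult_left_mono add_mono mult_mono) auto
  finally have A: "ip (m (Suc (Suc \<alpha>))) (m \<gamma>) \<le> q * (3 / 2 - 2 * q)" by (simp add: \<nu>_eq)
  have "0 \<le> q * (3 / 2 - 2 * q)" using q_nonneg q_le by (intro mult_nonneg_nonneg) auto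
  then have "e \<beta> * ip (m (Suc (Suc \<alpha>))) (m \<gamma>) \<le> (1 - q) * (q * (3 / 2 - 2 * q))"
    using pos e A q1 ip_m_nonneg[OF q_small] by (intro mult_mono) auto
  moreover have "0 \<le> e \<gamma> * ip (m (Suc (Suc \<alpha>))) (m \<beta>)"
    using pos ip_m_nonneg[OF q_small] by simp
  ultimately have L: "e \<beta> * ip (m (Suc (Suc \<alpha>))) (m \<gamma>) - e \<gamma> * ip (m (Suc (Suc \<alpha>))) (m \<beta>)
      \<le> (1 - q) * (q * (3 / 2 - 2 * q))" by linarith
  have "e \<gamma> / e \<beta> * ip (m \<beta>) (m \<beta>) \<le> 1 * (q * (1 * 1 + \<nu> * (1 * 1)))"
  proof (intro mult_mono)
    show "e \<gamma> / e \<beta> \<le> 1"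
      using e_antimono[OF q_small assms(2)] e_pos[OF q_small, of \<beta>] by simp
    have "ip (m \<beta>) (m \<beta>) \<le> q * (e (Suc j) * e (Suc j) + \<nu> * (e j * e j))"
      using ip_m_le[OF q_small, of j j] by (simp add: j)
    also have "\<dots> \<le> q * (1 * 1 + \<nu> * (1 * 1))"
      using pos le1 \<nu>_nonneg q_nonneg by (intro mult_left_mono add_mono mult_mono) auto
    finally show "ip (m \<beta>) (m \<beta>) \<le> q * (1 * 1 + \<nu> * (1 * 1))" .
  qed (use ip_self_nonneg in auto)
  then have B: "e \<gamma> / e \<beta> * ip (m \<beta>) (m \<beta>) \<le> q * (3 / 2 - q)" by (simp add: \<nu>_eq)
  have "e \<beta> / e \<gamma> * ip (m \<gamma>) (m \<gamma>) \<le> e \<beta> * (q * (2 * e (Suc k) + e k))"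
    using ratio_ip_m_le[of \<beta> k] by (simp add: k)
  also have "\<dots> \<le> (1 - q) * (q * (2 * (1 - q) + 1))"
    using pos le1 e q1 q_nonneg by (intro mult_mono add_mono mult_nonneg_nonneg add_nonneg_nonneg) auto
  finally have C: "e \<beta> / e \<gamma> * ip (m \<gamma>) (m \<gamma>) \<le> (1 - q) * (q * (3 - 2 * q))" by simp
  have "1 * (1 - q) * (1 - 2 * q) + (1 - q) * (q * (3 / 2 - 2 * q))
      + (q * (3 / 2 - q) + (1 - q) * (q * (3 - 2 * q))) / 4
      = 1 - 3 / 8 * q - q\<^sup>2 * (3 - 5 / 2 * q)"
    by (simp add: power2_eq_square field_simps)
  also have "\<dots> \<le> 1"
  proof -
    have "0 \<le> q\<^sup>2 * (3 - 5 / 2 * q)" using q_le by (intro mult_nonneg_nonneg) auto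
    then show ?thesis using q_nonneg by linarith
  qed
  finally show ?thesis
    using spider_bound_le_split[of \<alpha> \<beta> \<gamma>] T L B C by argo
qed

end

context
  assumes q_large: "1 / 4 \<le> q"
begin

text \<open>These four consecutive values start the induction, with step four, in
  \<open>e_le_half\<close>.\<close>

lemma e_le_half_initial:
  "e 3 \<le> 1 / 2" "e 4 \<le> 1 / 2" "e 5 \<le> 1 / 2" "e 6 \<le> 1 / 2"
proof -
  define k1 k2 where "k1 = ip f (N f)" and "k2 = ip f (N (N f))"
  have k1': "k1 \<le> q / 2 - q\<^sup>2" unfolding k1_def by (rule ip_N_f_le)
  have k2: "0 \<le> k2" using ip_word_nonneg[of f 2 0] by (simp add: k2_def numeral_2_eq_2)
  note red = numeral_eq_Suc e_Suc_Suc e_1 ip_simps q_def[symmetric] N_simps k1_def[symmetric] k2_def[symmetric]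
  have e3: "e 3 = 1 - 2 * q" by (simp add: red)
  have e4: "e 4 = 1 - 3 * q + q\<^sup>2 + k1"
    by (simp add: red power2_eq_square algebra_simps)
  have e5: "e 5 = e 4 - q * e 3 + k1"
    by (simp add: red power2_eq_square algebra_simps)
  have e6: "e 6 = e 5 - q * e 4 + (1 - q) * k1 - k2"
    by (simp add: red power2_eq_square algebra_simps)
  show "e 3 \<le> 1 / 2" using q_large by (simp add: e3)
  show "e 4 \<le> 1 / 2" using q_large k1' by (simp add: e4)
  note qq = q_square_le
  have "e 5 \<le> 1 - 3 * q + q\<^sup>2"
    using k1' by (simp add: e5 e4 e3 power2_eq_square algebra_simps)
  then show "e 5 \<le> 1 / 2" using qq q_large by linarith
  have "(3 - 2 * q) * k1 \<le> (3 - 2 * q) * (q / 2 - q\<^sup>2)"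
    using k1' q_le by (intro mult_left_mono) auto
  then have "e 6 \<le> 1 - 7 / 2 * q + 2 * q\<^sup>2 + q * q\<^sup>2"
    using k2 by (simp add: e6 e5 e4 e3 power2_eq_square algebra_simps)
  moreover have "q * q\<^sup>2 \<le> q * (1 / 2)"
    using qq q_le q_nonneg by (intro mult_left_mono) auto
  ultimately show "e 6 \<le> 1 / 2" using qq q_large by linarith
qed

end

end

section \<open>Skew kernels\<close>

instantiation "fun" :: (type, real_vector) real_vector
begin
definition "c *\<^sub>R f = (\<lambda>x. c *\<^sub>R f x)" for f :: "'a \<Rightarrow> 'b"
instance
  by standard (simp_all add: scaleR_fun_def fun_eq_iff scaleR_add_right scaleR_add_left)
end

text \<open>For a tournament, \<open>s x y\<close> is \<open>1\<close> or \<open>- 1\<close>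
  according to the direction of the arc between \<open>x\<close> and \<open>y\<close>, so that
  \<open>(1 + s x y) / 2\<close> is the indicator of the arc from \<open>x\<close> to
  \<open>y\<close> off the diagonal.\<close>

locale skew_kernel =
  fixes V :: "'a set" and s :: "'a \<Rightarrow> 'a \<Rightarrow> real"
  assumes finite_V: "finite V" and nonempty_V: "V \<noteq> {}"
    and skew_s: "s x y = - s y x" and abs_s: "\<bar>s x y\<bar> \<le> 1"
begin

definition mean :: "('a \<Rightarrow> real) \<Rightarrow> real" where
  "mean g = (\<Sum>x\<in>V. g x) / real (card V)"

lemma card_V_pos: "0 < real (card V)"
  using finite_V nonempty_V by (simp add: card_gt_0_iff)

lemma mean_const [simp]: "mean (\<lambda>_. c) = c"
  using card_V_pos by (simp add: mean_def)

lemma mean_add: "mean (\<lambda>x. g x + h x) = mean g + mean h"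
  by (simp add: mean_def sum.distrib add_divide_distrib)

lemma mean_diff: "mean (\<lambda>x. g x - h x) = mean g - mean h"
  by (simp add: mean_def sum_subtractf diff_divide_distrib)

lemma mean_minus: "mean (\<lambda>x. - g x) = - mean g"
  by (simp add: mean_def sum_negf)

lemma mean_mult_left: "mean (\<lambda>x. c * g x) = c * mean g"
  by (simp add: mean_def sum_distrib_left)

lemma mean_mult_right: "mean (\<lambda>x. g x * c) = mean g * c"
  by (simp add: mean_def sum_distrib_right)

lemmas mean_simps = mean_add mean_diff mean_minus mean_mult_left mean_mult_right

lemma mean_mono: "(\<And>x. x \<in> V \<Longrightarrow> g x \<le> h x) \<Longrightarrow> mean g \<le> mean h"
  unfolding mean_def by (intro divide_right_mono sum_mono) auto

lemma mean_cong: "(\<And>x. x \<in> V \<Longrightarrow> g x = h x) \<Longrightarrow> mean g = mean h"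
  unfolding mean_def by simp

lemma mean_nonneg: "(\<And>x. x \<in> V \<Longrightarrow> 0 \<le> g x) \<Longrightarrow> 0 \<le> mean g"
  using mean_mono[of "\<lambda>_. 0" g] by simp

lemma mean_swap: "mean (\<lambda>x. mean (\<lambda>y. h x y)) = mean (\<lambda>y. mean (\<lambda>x. h x y))"
  unfolding mean_def sum_divide_distrib by (subst sum.swap) (rule refl)

definition ip :: "('a \<Rightarrow> real) \<Rightarrow> ('a \<Rightarrow> real) \<Rightarrow> real" where
  "ip g h = mean (\<lambda>x. g x * h x)"

sublocale semi_inner ip
proof
  fix g h k :: "'a \<Rightarrow> real" and c :: real
  show "ip (g + h) k = ip g k + ip h k"
    by (simp add: ip_def mean_add[symmetric] algebra_simps)
  show "ip (c *\<^sub>R g) h = c * ip g h"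
    by (simp add: ip_def scaleR_fun_def mean_mult_left[symmetric] mult.assoc)
  show "ip g h = ip h g" by (simp add: ip_def mult.commute)
  show "0 \<le> ip g g" unfolding ip_def by (rule mean_nonneg) simp
qed

lemma mean_ip: "mean g = ip g (\<lambda>_. 1)"
  by (simp add: ip_def)

lemma ip_const: "ip g (\<lambda>_. c) = c * mean g"
  by (simp add: ip_def mean_simps)

lemma ip_self_eq_0D:
  assumes "ip g g = 0" and "x \<in> V"
  shows "g x = 0"
  using assms finite_V card_V_pos
  by (auto simp: ip_def mean_def sum_nonneg_eq_0_iff)

definition S :: "('a \<Rightarrow> real) \<Rightarrow> 'a \<Rightarrow> real" where
  "S g x = mean (\<lambda>y. s x y * g y)"

definition centred :: "('a \<Rightarrow> real) \<Rightarrow> 'a \<Rightarrow> real" where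
  "centred g x = g x - mean g"

text \<open>The compression of \<open>S\<close> to the centred functions, extended by zero to the
  constants.\<close>

definition K :: "('a \<Rightarrow> real) \<Rightarrow> 'a \<Rightarrow> real" where
  "K g = centred (S (centred g))"

definition score :: "'a \<Rightarrow> real" where "score = S (\<lambda>_. 1)"

lemma linear_S: "linear S"
  by (rule linearI)
     (simp_all add: S_def fun_eq_iff scaleR_fun_def mean_add[symmetric] mean_mult_left[symmetric] algebra_simps)

lemma linear_centred: "linear centred"
  by (rule linearI)
     (simp_all add: centred_def fun_eq_iff scaleR_fun_def plus_fun_def mean_simps algebra_simps)

lemma linear_K: "linear K"
  using linear_compose[OF linear_compose[OF linear_centred linear_S] linear_centred]
  by (simp add: K_def[abs_def] o_def)

lemma ip_S: "ip (S g) h = - ip g (S h)"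
proof -
  have "ip (S g) h = mean (\<lambda>x. mean (\<lambda>y. s x y * g y * h x))"
    by (simp add: ip_def S_def mean_mult_right)
  also have "\<dots> = mean (\<lambda>y. mean (\<lambda>x. s x y * g y * h x))" by (rule mean_swap)
  also have "\<dots> = mean (\<lambda>y. mean (\<lambda>x. - (g y * (s y x * h x))))"
  proof -
    have "s x y * g y * h x = - (g y * (s y x * h x))" for x y
      using skew_s[of x y] by simp
    then show ?thesis by presburger
  qed
  also have "\<dots> = - ip g (S h)" by (simp add: ip_def S_def mean_simps)
  finally show ?thesis .
qed

lemma ip_S_self: "ip g (S g) = 0"
  using ip_S[of g g] ip_commute[of "S g" g] by simp

lemma mean_S: "mean (S g) = - ip score g"
  using ip_S[of g "\<lambda>_. 1"] by (simp add: mean_ip score_def ip_commute)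

lemma mean_score: "mean score = 0"
  using ip_S_self[of "\<lambda>_. 1"] mean_ip[of score] ip_commute score_def by metis

lemma mean_centred: "mean (centred g) = 0"
  by (simp add: centred_def[abs_def] mean_simps)

lemma ip_centred_right: "mean g = 0 \<Longrightarrow> ip g (centred h) = ip g h"
  by (simp add: centred_def[abs_def] ip_def right_diff_distrib mean_simps)

lemma ip_centred_left: "mean h = 0 \<Longrightarrow> ip (centred g) h = ip g h"
  using ip_centred_right ip_commute by metis

lemma ip_centred_centred: "ip (centred g) h = ip g (centred h)"
  by (metis ip_centred_left ip_centred_right mean_centred)

lemma ip_centred_self_le: "ip (centred g) (centred g) \<le> ip g g"
proof -
  have "ip (centred g) (centred g) = ip g g - (mean g)\<^sup>2"
    by (simp add: centred_def[abs_def] ip_def mean_simps algebra_simps power2_eq_square)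
  then show ?thesis by simp
qed

lemma skew_K: "ip (K g) h = - ip g (K h)"
  by (simp add: K_def ip_centred_centred ip_S)

text \<open>The mean square of \<open>s\<close> over all pairs is at most \<open>1\<close>. A skew
  kernel carries the vector \<open>score\<close> twice, as row means and as column means, and
  likewise the pair \<open>g\<close>, \<open>k\<close> twice; comparing \<open>s\<close> with the
  skew kernel made from these pieces gives the inequality. The scalar \<open>c\<close> is free, so
  that \<open>g\<close> need not be a unit vector.\<close>

lemma Hilbert_Schmidt:
  assumes g: "mean g = 0" and k: "k = centred (S g)"
  shows "2 * ip score score + 4 * (c * ip k k) \<le> 1 + 2 * (c * ip k k) * (c * ip g g)"
proof -
  have mk: "mean k = 0" by (simp add: k mean_centred)
  have kS: "ip k (S g) = ip k k" using ip_centred_right[OF mk, of "S g"] k by simp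
  have gk: "ip g k = 0" using ip_centred_right[OF g, of "S g"] ip_S_self[of g] k by simp
  let ?mm = "\<lambda>h. mean (\<lambda>x. mean (h x))"
  let ?A = "\<lambda>x y. score x - score y"
  let ?B = "\<lambda>x y. k x * g y - g x * k y"
  have sA: "?mm (\<lambda>x y. s x y * ?A x y) = 2 * ip score score"
  proof -
    have "?mm (\<lambda>x y. s x y * ?A x y) = ?mm (\<lambda>x y. score x * (s x y * 1) - s x y * score y)"
      by (simp add: algebra_simps)
    also have "\<dots> = ip score (S (\<lambda>_. 1)) - ip (\<lambda>_. 1) (S score)"
      by (simp add: mean_simps ip_def S_def)
    also have "\<dots> = 2 * ip score score"
      using ip_S[of "\<lambda>_. 1" score] by (simp add: score_def)
    finally show ?thesis .
  qed
  have sB: "?mm (\<lambda>x y. s x y * ?B x y) = 2 * ip k k"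
  proof -
    have "?mm (\<lambda>x y. s x y * ?B x y) = ?mm (\<lambda>x y. k x * (s x y * g y) - g x * (s x y * k y))"
      by (simp add: algebra_simps)
    also have "\<dots> = ip k (S g) - ip g (S k)" by (simp add: mean_simps ip_def S_def)
    also have "\<dots> = 2 * ip k k"
      using ip_S[of g k] kS ip_commute[of "S g" k] by simp
    finally show ?thesis .
  qed
  have AA: "?mm (\<lambda>x y. ?A x y * ?A x y) = 2 * ip score score"
  proof -
    have "?mm (\<lambda>x y. ?A x y * ?A x y) = ?mm (\<lambda>x y. score x * score x + score y * score y - 2 * (score x * score y))"
      by (simp add: algebra_simps)
    also have "\<dots> = 2 * ip score score" by (simp add: mean_simps mean_score ip_def)
    finally show ?thesis .
  qed
  have AB: "?mm (\<lambda>x y. ?A x y * ?B x y) = 0"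
  proof -
    have "?mm (\<lambda>x y. ?A x y * ?B x y)
      = ?mm (\<lambda>x y. (score x * k x) * g y - (score x * g x) * k y - k x * (score y * g y) + g x * (score y * k y))"
      by (simp add: algebra_simps)
    also have "\<dots> = 0" by (simp add: mean_simps g mk)
    finally show ?thesis .
  qed
  have BB: "?mm (\<lambda>x y. ?B x y * ?B x y) = 2 * (ip k k * ip g g)"
  proof -
    have "?mm (\<lambda>x y. ?B x y * ?B x y)
      = ?mm (\<lambda>x y. (k x * k x) * (g y * g y) + (g x * g x) * (k y * k y) - 2 * ((g x * k x) * (g y * k y)))"
      by (simp add: algebra_simps)
    also have "\<dots> = 2 * (ip k k * ip g g)" using gk by (simp add: mean_simps ip_def)
    finally show ?thesis .
  qed
  have ss: "?mm (\<lambda>x y. s x y * s x y) \<le> 1"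
  proof -
    have "s x y * s x y \<le> 1" for x y
      using abs_s[of x y] by (metis abs_square_le_1 power2_eq_square)
    then have "?mm (\<lambda>x y. s x y * s x y) \<le> ?mm (\<lambda>_ _. 1)" by (intro mean_mono)
    then show ?thesis by simp
  qed
  have "0 \<le> ?mm (\<lambda>x y. (s x y - ?A x y - c * ?B x y) * (s x y - ?A x y - c * ?B x y))"
    by (intro mean_nonneg) simp
  also have "\<dots> = ?mm (\<lambda>x y. s x y * s x y - 2 * (s x y * ?A x y) - 2 * c * (s x y * ?B x y)
      + ?A x y * ?A x y + 2 * c * (?A x y * ?B x y) + c * c * (?B x y * ?B x y))"
    by (intro mean_cong) (simp add: algebra_simps)
  also have "\<dots> = ?mm (\<lambda>x y. s x y * s x y) - 2 * ?mm (\<lambda>x y. s x y * ?A x y)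
      - 2 * c * ?mm (\<lambda>x y. s x y * ?B x y) + ?mm (\<lambda>x y. ?A x y * ?A x y)
      + 2 * c * ?mm (\<lambda>x y. ?A x y * ?B x y) + c * c * ?mm (\<lambda>x y. ?B x y * ?B x y)"
    by (simp only: mean_add mean_diff mean_mult_left)
  also have "\<dots> = ?mm (\<lambda>x y. s x y * s x y) - 2 * ip score score - 4 * (c * ip k k) + 2 * (c * ip k k) * (c * ip g g)"
    unfolding sA sB AA AB BB by (simp add: algebra_simps)
  finally show ?thesis using ss by simp
qed

lemma q_le_half: "0 \<le> 1 / 2 - ip score score"
  using Hilbert_Schmidt[of "\<lambda>_. 0" _ 0] by simp

text \<open>The previous inequality with the best scalar
  \<open>c = 1 / \<langle>g, g\<rangle>\<close>.\<close>

lemma centred_S_bound: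
  assumes "mean g = 0"
  shows "ip (centred (S g)) (centred (S g)) \<le> (1 / 2 - ip score score) * ip g g"
proof (cases "ip g g = 0")
  case True
  have "S g x = 0" for x
    unfolding S_def using ip_self_eq_0D[OF True] mean_cong[of "\<lambda>y. s x y * g y" "\<lambda>_. 0"] by simp
  then have "S g = (\<lambda>_. 0)" by blast
  then have "centred (S g) = (\<lambda>_. 0)" by (simp add: centred_def[abs_def])
  then show ?thesis using True by (simp add: ip_def)
next
  case False
  let ?k = "ip (centred (S g)) (centred (S g))"
  have pos: "0 < ip g g" using False ip_self_nonneg[of g] by simp
  have "?k / ip g g \<le> 1 / 2 - ip score score"
    using Hilbert_Schmidt[OF assms refl, of "1 / ip g g"] False by simp
  then show ?thesis using pos by (simp add: divide_le_eq)
qed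

lemma bound_K: "ip (K g) (K g) \<le> (1 / 2 - ip score score) * ip g g"
proof -
  have q: "0 \<le> 1 / 2 - ip score score" by (rule q_le_half)
  have "ip (K g) (K g) \<le> (1 / 2 - ip score score) * ip (centred g) (centred g)"
    unfolding K_def by (rule centred_S_bound[OF mean_centred])
  also have "\<dots> \<le> (1 / 2 - ip score score) * ip g g"
    by (intro mult_left_mono ip_centred_self_le q)
  finally show ?thesis .
qed

text \<open>The constant part of \<open>S g\<close> costs at most
  \<open>\<langle>score, score\<rangle>\<close>, which is exactly what
  \<open>centred_S_bound\<close> leaves below \<open>1 / 2\<close>.\<close>

lemma ip_S_S_le:
  assumes "mean g = 0"
  shows "ip (S g) (S g) \<le> ip g g / 2"
proof -
  have "ip (S g) (S g) = ip (centred (S g)) (centred (S g)) + (mean (S g))\<^sup>2"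
    by (simp add: centred_def[abs_def] ip_def mean_simps algebra_simps power2_eq_square)
  also have "\<dots> \<le> (1 / 2 - ip score score) * ip g g + ip score score * ip g g"
    using centred_S_bound[OF assms] Cauchy_Schwarz[of score g] by (simp add: mean_S)
  finally show ?thesis by (simp add: algebra_simps)
qed

section \<open>Directed walks of a skew kernel\<close>

text \<open>With \<open>J = mean\<close>, this is \<open>(J + S)\<^sup>k 1\<close>: the number of
  directed walks with \<open>k\<close> arcs that start at \<open>x\<close>, divided by
  \<open>(n / 2)\<^sup>k\<close>, where a step that stays at a vertex counts
  \<open>1 / 2\<close>.\<close>

fun u :: "nat \<Rightarrow> 'a \<Rightarrow> real" where
  "u 0 = (\<lambda>_. 1)"
| "u (Suc k) = (\<lambda>x. mean (u k) + S (u k) x)"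

declare u.simps(2) [simp del]

definition e :: "nat \<Rightarrow> real" where "e k = mean (u k)"

lemma u_decomp: "u k = (\<lambda>_. e k) + centred (u k)"
  by (simp add: centred_def fun_eq_iff e_def)

lemma S_const: "S (\<lambda>_. c) = c *\<^sub>R score"
  by (simp add: score_def S_def fun_eq_iff scaleR_fun_def mean_mult_left[symmetric] mult.commute)

sublocale walk: walk_recursion ip K "1 / 2 - ip score score" score "ip score score" e "\<lambda>k. centred (u k)"
proof (intro walk_recursion.intro skew_contraction.intro walk_recursion_axioms.intro
    skew_contraction_axioms.intro)
  show "semi_inner ip" ..
  show "linear K" by (rule linear_K)
  show "ip (K v) w = - ip v (K w)" for v w by (rule skew_K)
  show "ip (K v) (K v) \<le> (1 / 2 - ip score score) * ip v v" for v by (rule bound_K)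
  show "0 \<le> 1 / 2 - ip score score" by (rule q_le_half)
  show "e 0 = 1" by (simp add: e_def)
  show "centred (u 0) = 0" by (simp add: centred_def fun_eq_iff)
  show "e (Suc k) = e k - ip score (centred (u k))" for k
    by (simp add: e_def u.simps(2) mean_simps mean_S ip_centred_right mean_score)
  show "centred (u (Suc k)) = e k *\<^sub>R score + K (centred (u k))" for k
  proof -
    have idem: "centred (centred g) = centred g" for g
      using mean_centred[of g] by (simp add: centred_def[of "centred g"] fun_eq_iff)
    have "S (u k) = e k *\<^sub>R score + S (centred (u k))"
      by (subst u_decomp) (simp add: linear_add[OF linear_S] S_const)
    then have "u (Suc k) = (\<lambda>_. e k) + (e k *\<^sub>R score + S (centred (u k)))"
      by (simp add: fun_eq_iff e_def u.simps(2))
    moreover have "centred (\<lambda>_. c) = 0" "centred score = score" for c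
      by (simp_all add: centred_def fun_eq_iff mean_score)
    ultimately show ?thesis
      by (simp only: linear_add[OF linear_centred] linear_scale[OF linear_centred] K_def idem) simp
  qed
qed (simp_all)

lemma abs_S_le:
  assumes "\<And>y. 0 \<le> g y"
  shows "\<bar>S g x\<bar> \<le> mean g"
proof -
  have "\<bar>s x y * g y\<bar> \<le> g y" for y
    using mult_right_mono[OF abs_s assms] assms[of y] by (simp add: abs_mult)
  then have "mean (\<lambda>y. s x y * g y) \<le> mean g" "mean (\<lambda>y. - (s x y * g y)) \<le> mean g"
    by (intro mean_mono; metis abs_le_D1 abs_le_D2)+
  then show ?thesis by (simp add: S_def mean_minus)
qed

lemma u_nonneg: "0 \<le> u k x"
proof (induction k arbitrary: x)
  case (Suc k)
  from abs_S_le[of "u k" x] Suc show ?case by (simp add: u.simps(2))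
qed simp

lemma e_nonneg: "0 \<le> e k"
  unfolding e_def by (intro mean_nonneg u_nonneg)

lemma abs_S_u: "\<bar>S (u k) x\<bar> \<le> e k"
  unfolding e_def by (intro abs_S_le u_nonneg)

lemma u_Suc_le: "u (Suc k) x \<le> 2 * e k"
  using abs_S_u[of k x] by (simp add: e_def u.simps(2))

text \<open>The function of a leg with \<open>Suc k\<close> arcs, the first of which points to the
  centre: \<open>(J - S) (u k)\<close>.\<close>

definition rev_u :: "nat \<Rightarrow> 'a \<Rightarrow> real" where
  "rev_u k x = e k - S (u k) x"

lemma rev_u_le: "rev_u k x \<le> 2 * e k"
  using abs_S_u[of k x] by (auto simp: rev_u_def)

text \<open>Walks that end at \<open>x\<close> instead of starting there. Cutting a directed walk
  into two pieces pairs \<open>v\<close> with \<open>u\<close>, and the pointwise bound on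
  \<open>v\<close> then makes \<open>e\<close> almost submultiplicative.\<close>

fun v :: "nat \<Rightarrow> 'a \<Rightarrow> real" where
  "v 0 = (\<lambda>_. 1)"
| "v (Suc k) = (\<lambda>x. mean (v k) - S (v k) x)"

declare v.simps(2) [simp del]

lemma v_nonneg: "0 \<le> v k x"
proof (induction k arbitrary: x)
  case (Suc k)
  from abs_S_le[of "v k" x] Suc show ?case by (simp add: v.simps(2))
qed simp

lemma ip_v_u: "ip (v i) (u j) = e (i + j)"
proof (induction i arbitrary: j)
  case 0 then show ?case by (simp add: ip_def e_def)
next
  case (Suc i)
  have "ip (v (Suc i)) (u j) = mean (v i) * mean (u j) - ip (S (v i)) (u j)"
    by (simp add: ip_def v.simps(2) left_diff_distrib mean_simps)
  also have "\<dots> = ip (v i) (u (Suc j))"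
    by (simp only: ip_S) (simp add: ip_def u.simps(2) distrib_left mean_simps)
  finally show ?case using Suc.IH by simp
qed

lemma e_add_le: "e (Suc i + j) \<le> 2 * e i * e j"
proof -
  have ve: "mean (v i) = e i" using ip_v_u[of i 0] by (simp add: ip_def)
  have "e (Suc i + j) = mean (\<lambda>x. v (Suc i) x * u j x)" using ip_v_u by (simp add: ip_def)
  also have "\<dots> \<le> mean (\<lambda>x. 2 * e i * u j x)"
  proof (intro mean_mono mult_right_mono u_nonneg)
    fix x show "v (Suc i) x \<le> 2 * e i" using abs_S_le[of "v i" x] v_nonneg ve by (simp add: v.simps(2))
  qed
  also have "\<dots> = 2 * e i * e j" by (simp add: mean_simps e_def)
  finally show ?thesis .
qed

text \<open>\<open>e 3 \<le> 1 / 2\<close> and \<open>e_add_le\<close> give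
  \<open>e (k + 4) \<le> 2 e 3 e k \<le> e k\<close>.\<close>

lemma e_le_half:
  assumes "1 / 4 \<le> ip score score" and "3 \<le> k"
  shows "e k \<le> 1 / 2"
  using assms(2)
proof (induction k rule: less_induct)
  case (less k)
  note init = walk.e_le_half_initial[OF assms(1)]
  consider "k = 3" | "k = 4" | "k = 5" | "k = 6" | "7 \<le> k" using less.prems by linarith
  then show ?case
  proof cases
    case 5
    define j where "j = k - 4"
    have j: "k = Suc 3 + j" "e j \<le> 1 / 2" using 5 less.IH[of j] by (auto simp: j_def)
    have "e k \<le> 2 * e 3 * e j" using e_add_le[of 3 j] j by simp
    also have "\<dots> \<le> 1 * e j" using init e_nonneg by (intro mult_right_mono) auto
    finally show ?thesis using j by simp
  qed (use init in simp_all)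
qed

lemma e_le_1: "e k \<le> 1"
proof (cases "ip score score \<le> 1 / 4")
  case True then show ?thesis by (rule walk.e_le_1)
next
  case False
  consider "k = 0" | "k = Suc 0" | "k = Suc (Suc 0)" | "3 \<le> k" by linarith
  then show ?thesis
    using e_le_half[of k] False walk.e_0 walk.e_1 walk.e_2 walk.q_nonneg by cases auto
qed

section \<open>Three legs\<close>

text \<open>The density of the spider with legs \<open>Suc a\<close>, \<open>Suc b\<close>,
  \<open>Suc c\<close>, times \<open>2\<close> to the number of its arcs.\<close>

definition spider_density :: "nat \<Rightarrow> nat \<Rightarrow> nat \<Rightarrow> real" where
  "spider_density a b c = mean (\<lambda>x. u (Suc a) x * u (Suc b) x * rev_u c x)"

lemma spider_density_commute: "spider_density a b c = spider_density b a c"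
  by (simp add: spider_density_def mult.commute)

text \<open>Two legs that differ only in the direction of the first arc have the functions
  \<open>e b + x\<close> and \<open>e b - x\<close>, whose product is at most
  \<open>(e b)\<^sup>2\<close> at every vertex.\<close>

lemma spider_density_equal: "spider_density a b b \<le> 1"
proof -
  have "u (Suc a) x * u (Suc b) x * rev_u b x \<le> u (Suc a) x" for x
  proof -
    have "u (Suc b) x * rev_u b x = (e b)\<^sup>2 - (S (u b) x)\<^sup>2"
      by (simp add: rev_u_def e_def u.simps(2) power2_eq_square algebra_simps)
    also have "\<dots> \<le> 1" using e_le_1[of b] e_nonneg[of b] power_le_one[of "e b" 2]
        zero_le_power2[of "S (u b) x"] by linarith
    finally show ?thesis
      using mult_left_mono[of "u (Suc b) x * rev_u b x" 1 "u (Suc a) x"] u_nonneg[of "Suc a" x]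
      by (simp only: mult.assoc mult_1_right)
  qed
  then have "spider_density a b b \<le> e (Suc a)"
    unfolding spider_density_def e_def by (intro mean_mono)
  then show ?thesis using e_le_1[of "Suc a"] by simp
qed

text \<open>The inequality between the geometric and the arithmetic mean, weighted by
  \<open>e b\<close> and \<open>e c\<close>, replaces the product of the last two legs by
  \<open>e b e c + S d + (S d)\<^sup>2 / (4 e b e c)\<close> with a centred \<open>d\<close> that is
  small when the two legs are similar. In the linear term \<open>S\<close> moves to the first leg,
  which it extends by one arc; in the quadratic term the first leg is at most \<open>2 e a\<close>,
  and \<open>S\<close> has norm at most \<open>1 / \<surd>2\<close> on centred functions.\<close>

lemma spider_density_le_bound:
  assumes pos: "0 < e b" "0 < e c"
  shows "spider_density a b c \<le> walk.spider_bound a b c"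
proof -
  define d where "d = e c *\<^sub>R centred (u b) - e b *\<^sub>R centred (u c)"
  define C where "C = 1 / (4 * e b * e c)"
  have C: "0 \<le> C" using pos by (simp add: C_def)
  have md: "mean d = 0"
    by (simp add: d_def fun_diff_def scaleR_fun_def mean_simps mean_centred)
  have Sd: "S d x = e c * S (u b) x - e b * S (u c) x" for x
  proof -
    have "d = e c *\<^sub>R u b - e b *\<^sub>R u c"
      by (simp add: d_def centred_def fun_eq_iff scaleR_fun_def e_def algebra_simps)
    then show ?thesis
      by (simp add: linear_diff[OF linear_S] linear_scale[OF linear_S]) (simp add: scaleR_fun_def)
  qed
  have point: "u (Suc b) x * rev_u c x \<le> e b * e c + S d x + C * (S d x * S d x)" for x
  proof -
    let ?y = "S (u b) x" and ?z = "S (u c) x"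
    have "e b * e c + S d x + C * (S d x * S d x) - (e b + ?y) * (e c - ?z)
        = C * (e c * ?y + e b * ?z)\<^sup>2"
      using pos by (simp add: C_def Sd field_simps power2_eq_square)
    moreover have "0 \<le> C * (e c * ?y + e b * ?z)\<^sup>2" using C by simp
    ultimately show ?thesis by (simp add: rev_u_def e_def u.simps(2))
  qed
  have ipU: "ip (u (Suc a)) (S d) = - ip (centred (u (Suc (Suc a)))) d"
  proof -
    have "ip (u (Suc a)) (S d) = - ip (S (u (Suc a))) d" by (simp add: ip_S)
    also have "S (u (Suc a)) = u (Suc (Suc a)) - (\<lambda>_. e (Suc a))"
      by (simp add: fun_eq_iff e_def u.simps(2)[of "Suc a"])
    also have "ip (u (Suc (Suc a)) - (\<lambda>_. e (Suc a))) d = ip (u (Suc (Suc a))) d"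
      using ip_const[of d "e (Suc a)"] md by (simp add: ip_diff_right ip_commute[of _ d])
    also have "\<dots> = ip (centred (u (Suc (Suc a)))) d"
      using ip_centred_left[OF md] by simp
    finally show ?thesis .
  qed
  have "spider_density a b c \<le> mean (\<lambda>x. u (Suc a) x * (e b * e c + S d x + C * (S d x * S d x)))"
    unfolding spider_density_def mult.assoc[of "u (Suc a) _"]
    by (intro mean_mono mult_left_mono point u_nonneg)
  also have "\<dots> \<le> mean (\<lambda>x. u (Suc a) x * (e b * e c) + u (Suc a) x * S d x + 2 * e a * C * (S d x * S d x))"
  proof (rule mean_mono)
    fix x
    have "u (Suc a) x * (C * (S d x * S d x)) \<le> 2 * e a * (C * (S d x * S d x))"
      using C by (intro mult_right_mono u_Suc_le) auto
    then show "u (Suc a) x * (e b * e c + S d x + C * (S d x * S d x))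
        \<le> u (Suc a) x * (e b * e c) + u (Suc a) x * S d x + 2 * e a * C * (S d x * S d x)"
      by (simp add: algebra_simps)
  qed
  also have "\<dots> = e (Suc a) * (e b * e c) - ip (centred (u (Suc (Suc a)))) d + 2 * e a * C * ip (S d) (S d)"
    by (simp only: mean_add mean_mult_left mean_mult_right ip_def[symmetric] e_def[symmetric] ipU)
  also have "\<dots> \<le> e (Suc a) * (e b * e c) - ip (centred (u (Suc (Suc a)))) d + 2 * e a * C * (ip d d / 2)"
    using C e_nonneg[of a] by (intro add_left_mono mult_left_mono ip_S_S_le md) auto
  also have "\<dots> = walk.spider_bound a b c"
    by (simp add: walk.spider_bound_def d_def C_def ip_diff_right)
  finally show ?thesis .
qed

text \<open>When the scores vary much, there are so few long walks that pointwise bounds suffice: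
  the longest leg is at most \<open>2 e c \<le> 1\<close> everywhere, and what remains is a
  path.\<close>

lemma spider_density_large_q:
  assumes q: "1 / 4 \<le> ip score score" and "a < b" and "b < c" and "3 \<le> c"
  shows "spider_density a b c \<le> 1"
proof -
  have "spider_density a b c \<le> mean (\<lambda>x. u (Suc a) x * u (Suc b) x * 1)"
    unfolding spider_density_def
  proof (intro mean_mono mult_left_mono mult_nonneg_nonneg u_nonneg)
    show "rev_u c x \<le> 1" for x using rev_u_le[of c x] e_le_half[OF q assms(4)] by simp
  qed
  also have "\<dots> \<le> 1"
  proof (cases "b = 1")
    case True
    then have a: "a = 0" using assms by simp
    \<comment> \<open>The path of length three with its middle arc joining two equal halves has density exactly \<open>1\<close>.\<close>
    have "mean (\<lambda>x. u 1 x * u (Suc 1) x) = e 1 * e 1 + ip (u 1) (S (u 1))"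
      unfolding u.simps(2)[of 1] by (simp add: e_def ip_def distrib_left mean_add mean_mult_right)
    then show ?thesis using a True walk.e_1 by (simp add: ip_S_self)
  next
    case False
    have "mean (\<lambda>x. u (Suc a) x * u (Suc b) x * 1) \<le> mean (\<lambda>x. 2 * u (Suc b) x)"
    proof (rule mean_mono)
      fix x
      have "u (Suc a) x \<le> 2" using u_Suc_le[of a x] e_le_1[of a] by simp
      from mult_right_mono[OF this u_nonneg]
      show "u (Suc a) x * u (Suc b) x * 1 \<le> 2 * u (Suc b) x" by simp
    qed
    also have "\<dots> = 2 * e (Suc b)" by (simp only: mean_mult_left e_def)
    also have "\<dots> \<le> 1" using e_le_half[OF q, of "Suc b"] False assms by simp
    finally show ?thesis .
  qed
  finally show ?thesis .
qed

text \<open>The condition asks that the leg with the reversed arc be as long as another leg, or that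
  all lengths be distinct and it be the longest.\<close>

theorem spider_density_le_1:
  assumes "a = c \<or> b = c \<or> (a \<noteq> b \<and> a < c \<and> b < c)"
  shows "spider_density a b c \<le> 1"
proof -
  have main: "spider_density a b c \<le> 1" if "a < b" "b < c" for a b
  proof (cases "c = 2")
    case True
    then have ab: "a = 0" "b = 1" using that by auto
    have "0 < e 1" "0 < e 2" using walk.e_1 walk.e_2 walk.q_le by (auto simp: numeral_2_eq_2)
    then show ?thesis
      using spider_density_le_bound[of 1 2 0] walk.spider_bound_0_1_2 ab True by simp
  next
    case False
    then have c: "3 \<le> c" using that by simp
    show ?thesis
    proof (cases "ip score score \<le> 1 / 4")
      case True
      have "walk.spider_bound a b c \<le> 1"
      proof (cases "b = 1")
        case b: True
        then show ?thesis using walk.spider_bound_0_1[OF True c] that by simp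
      next
        case False
        then show ?thesis using walk.spider_bound_ge_2[OF True] that c by simp
      qed
      then show ?thesis
        using spider_density_le_bound[OF walk.e_pos[OF True] walk.e_pos[OF True], of a b c] by simp
    qed (use spider_density_large_q that c in simp)
  qed
  consider "a = c" | "b = c" | "a < b" "b < c" | "b < a" "a < c" using assms by linarith
  then show ?thesis
    using spider_density_equal spider_density_commute main by cases metis+
qed

end

section \<open>The oriented spider\<close>

definition leg_arc :: "nat \<Rightarrow> nat \<Rightarrow> nat \<Rightarrow> spider_vertex \<times> spider_vertex" where
  "leg_arc r i j = (if i = r \<and> j = 0 then (path_vertex i (Suc j), path_vertex i j)
     else (path_vertex i j, path_vertex i (Suc j)))"

text \<open>All arcs point away from the centre, except the first arc of leg
  \<open>r\<close>.\<close>

definition oriented_spider :: "nat list \<Rightarrow> nat \<Rightarrow> spider_vertex pair_pre_digraph" where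
  "oriented_spider as r =
     \<lparr> pverts = pverts (spider as),
       parcs = {leg_arc r i j | i j. i < length as \<and> j < as ! i} \<rparr>"

lemma path_vertex_eq_iff:
  "path_vertex i j = path_vertex k l \<longleftrightarrow> (j = 0 \<and> l = 0) \<or> (i = k \<and> j = l)"
  by (auto simp: path_vertex_def)

lemma parcs_oriented_spider_symmetrized:
  "parcs (oriented_spider as r) \<union> (parcs (oriented_spider as r))\<inverse> = parcs (spider as)"
proof -
  define P where "P = {(path_vertex i j, path_vertex i (Suc j)) | i j. i < length as \<and> j < as ! i}"
  have "p \<in> P \<union> P\<inverse>" if pH: "p \<in> parcs (oriented_spider as r)" for p
  proof -
    obtain i j where ij: "i < length as" "j < as ! i" and p: "p = leg_arc r i j"
      using pH unfolding oriented_spider_def by auto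
    have P: "(path_vertex i j, path_vertex i (Suc j)) \<in> P" using ij unfolding P_def by blast
    from p have "p = (path_vertex i j, path_vertex i (Suc j)) \<or> p = (path_vertex i (Suc j), path_vertex i j)"
      by (simp add: leg_arc_def split: if_splits)
    then show ?thesis using P by (elim disjE) (simp_all only: Un_iff converse_iff simp_thms)
  qed
  moreover have "p \<in> parcs (oriented_spider as r) \<union> (parcs (oriented_spider as r))\<inverse>" if pP: "p \<in> P" for p
  proof -
    obtain i j where ij: "i < length as" "j < as ! i"
      and p: "p = (path_vertex i j, path_vertex i (Suc j))" using pP unfolding P_def by blast
    have "leg_arc r i j \<in> parcs (oriented_spider as r)" using ij unfolding oriented_spider_def by auto
    then show ?thesis using p by (cases "i = r \<and> j = 0") (simp_all add: leg_arc_def)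
  qed
  moreover have "parcs (spider as) = P \<union> P\<inverse>" by (simp add: spider_def P_def Let_def)
  ultimately show ?thesis by blast
qed

lemma oriented_graph_oriented_spider: "oriented_graph (oriented_spider as r)"
proof -
  interpret G: pair_graph "spider as" by (rule pair_graph_spider)
  have sub: "parcs (oriented_spider as r) \<subseteq> parcs (spider as)"
    using parcs_oriented_spider_symmetrized by blast
  have verts: "pverts (oriented_spider as r) = pverts (spider as)" by (simp add: oriented_spider_def)
  show ?thesis
  proof
    show "finite (pverts (oriented_spider as r))" using G.pair_finite_verts verts by simp
    show "finite (parcs (oriented_spider as r))"
      using G.pair_finite_arcs sub by (rule rev_finite_subset)
    fix p assume "p \<in> parcs (oriented_spider as r)"
    then have "p \<in> parcs (spider as)" using sub by blast
    then show "fst p \<in> pverts (oriented_spider as r)" "snd p \<in> pverts (oriented_spider as r)" "fst p \<noteq> snd p"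
      using G.arc_fst_in_verts G.arc_snd_in_verts G.pair_no_loops verts by auto
  next
    show "asym (parcs (oriented_spider as r))"
      by (rule asymI)
         (auto simp: oriented_spider_def leg_arc_def path_vertex_eq_iff split: if_splits)
  qed
qed

lemma is_orientation_oriented_spider: "is_orientation (spider as) (oriented_spider as r)"
  using parcs_oriented_spider_symmetrized oriented_graph_oriented_spider
  by (simp add: is_orientation_def oriented_spider_def)

lemma card_parcs_oriented_spider:
  "card (parcs (oriented_spider as r)) = (\<Sum>i<length as. as ! i)"
proof -
  have "parcs (oriented_spider as r)
      = (\<lambda>(i, j). leg_arc r i j) ` (SIGMA i:{..<length as}. {..<as ! i})"
    by (auto simp: oriented_spider_def)
  moreover have "inj_on (\<lambda>(i, j). leg_arc r i j) (SIGMA i:{..<length as}. {..<as ! i})"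
    by (rule inj_onI) (auto simp: leg_arc_def path_vertex_eq_iff split: if_splits)
  ultimately show ?thesis by (simp add: card_image)
qed

lemma card_pverts_spider:
  assumes "as \<noteq> []"
  shows "card (pverts (spider as)) = Suc (\<Sum>i<length as. as ! i)"
proof -
  let ?I = "SIGMA i:{..<length as}. {..<as ! i}"
  have "pverts (spider as) = insert Centre ((\<lambda>(i, j). Leg i (Suc j)) ` ?I)"
  proof (intro set_eqI iffI)
    fix v assume "v \<in> pverts (spider as)"
    then obtain i j where "v = path_vertex i j" "i < length as" "j \<le> as ! i"
      by (auto simp: spider_def)
    then show "v \<in> insert Centre ((\<lambda>(i, j). Leg i (Suc j)) ` ?I)"
      by (cases j) (auto simp: path_vertex_def image_iff)
  next
    fix v assume "v \<in> insert Centre ((\<lambda>(i, j). Leg i (Suc j)) ` ?I)"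
    then consider "v = path_vertex 0 0" | i j where "v = path_vertex i (Suc j)" "i < length as" "j < as ! i"
      by (auto simp: path_vertex_def)
    then show "v \<in> pverts (spider as)"
    proof cases
      case 1
      moreover have "0 < length as" using assms by simp
      ultimately show ?thesis by (auto simp: spider_def)
    next
      case 2
      moreover have "Suc j \<le> as ! i" using 2 by simp
      ultimately show ?thesis unfolding spider_def by auto
    qed
  qed
  moreover have "inj_on (\<lambda>(i, j). Leg i (Suc j)) ?I" by (auto simp: inj_on_def)
  ultimately show ?thesis by (simp add: card_image card_insert_if image_iff)
qed

section \<open>Counting homomorphisms\<close>

fun walks :: "('b \<times> 'b) set \<Rightarrow> nat \<Rightarrow> 'b \<Rightarrow> 'b list set" where
  "walks E 0 x = {[]}"
| "walks E (Suc k) x = (\<Union>y\<in>{y. (x, y) \<in> E}. (#) y ` walks E k y)"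

definition rev_walks :: "('b \<times> 'b) set \<Rightarrow> nat \<Rightarrow> 'b \<Rightarrow> 'b list set" where
  "rev_walks E k x = (\<Union>y\<in>{y. (y, x) \<in> E}. (#) y ` walks E k y)"

text \<open>The possible images of leg \<open>i\<close>, without its centre, when the centre is
  mapped to \<open>x\<close>.\<close>

definition leg_walks :: "('b \<times> 'b) set \<Rightarrow> nat list \<Rightarrow> nat \<Rightarrow> nat \<Rightarrow> 'b \<Rightarrow> 'b list set" where
  "leg_walks E as r i x = (if i = r then rev_walks E (as ! i - 1) x else walks E (as ! i) x)"

lemma map_in_walks:
  assumes "\<And>j. j < k \<Longrightarrow> (g j, g (Suc j)) \<in> E"
  shows "map (\<lambda>j. g (Suc j)) [0..<k] \<in> walks E k (g 0)"
  using assms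
proof (induction k arbitrary: g)
  case (Suc k)
  have "map (\<lambda>j. g (Suc (Suc j))) [0..<k] \<in> walks E k (g (Suc 0))"
    using Suc.IH[of "\<lambda>j. g (Suc j)"] Suc.prems by simp
  moreover have "map (\<lambda>j. g (Suc j)) [0..<Suc k] = g (Suc 0) # map (\<lambda>j. g (Suc (Suc j))) [0..<k]"
    by (subst map_upt_Suc) simp
  ultimately show ?case using Suc.prems[of 0] by auto
qed simp

lemma map_in_leg_walks:
  assumes f: "f \<in> homs (oriented_spider as r) T" and i: "i < length as" "1 \<le> as ! i"
  shows "map (\<lambda>j. f (path_vertex i (Suc j))) [0..<as ! i] \<in> leg_walks (parcs T) as r i (f Centre)"
proof -
  have C: "f Centre = f (path_vertex i 0)" by (simp add: path_vertex_def)
  have arc: "(f (fst (leg_arc r i j)), f (snd (leg_arc r i j))) \<in> parcs T" if "j < as ! i" for j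
  proof -
    have "leg_arc r i j \<in> parcs (oriented_spider as r)" using i that by (auto simp: oriented_spider_def)
    then show ?thesis using f by (auto simp: homs_def)
  qed
  show ?thesis
  proof (cases "i = r")
    case False
    then show ?thesis
      using map_in_walks[of "as ! i" "\<lambda>j. f (path_vertex i j)" "parcs T"] arc
      by (simp add: leg_walks_def leg_arc_def C)
  next
    case True
    obtain k where k: "as ! i = Suc k" using i by (cases "as ! i") auto
    have "map (\<lambda>j. f (path_vertex i (Suc (Suc j)))) [0..<k] \<in> walks (parcs T) k (f (path_vertex i (Suc 0)))"
      using map_in_walks[of k "\<lambda>j. f (path_vertex i (Suc j))" "parcs T"] arc[of "Suc _"] True k
      by (simp add: leg_arc_def)
    moreover have "(f (path_vertex i (Suc 0)), f Centre) \<in> parcs T"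
      using arc[of 0] True k by (simp add: leg_arc_def C)
    moreover have "map (\<lambda>j. f (path_vertex i (Suc j))) [0..<Suc k]
        = f (path_vertex i (Suc 0)) # map (\<lambda>j. f (path_vertex i (Suc (Suc j)))) [0..<k]"
      by (subst map_upt_Suc) simp
    ultimately show ?thesis using True k by (auto simp: leg_walks_def rev_walks_def)
  qed
qed

lemma finite_walks: "finite E \<Longrightarrow> finite (walks E k x)"
proof (induction k arbitrary: x)
  case (Suc k)
  have "{y. (x, y) \<in> E} \<subseteq> snd ` E" by force
  then have "finite {y. (x, y) \<in> E}" using Suc.prems finite_subset by blast
  then show ?case using Suc by simp
qed simp

lemma finite_rev_walks:
  assumes "finite E" shows "finite (rev_walks E k x)"
proof -
  have "{y. (y, x) \<in> E} \<subseteq> fst ` E" by force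
  then have "finite {y. (y, x) \<in> E}" using assms finite_subset by blast
  then show ?thesis using finite_walks[OF assms] by (simp add: rev_walks_def)
qed

lemma finite_leg_walks: "finite E \<Longrightarrow> finite (leg_walks E as r i x)"
  by (simp add: leg_walks_def finite_walks finite_rev_walks)

lemma card_Cons_UNION_le:
  assumes "finite A"
  shows "card (\<Union>y\<in>A. (#) y ` B y) \<le> (\<Sum>y\<in>A. card (B y))"
proof -
  have "card (\<Union>y\<in>A. (#) y ` B y) \<le> (\<Sum>y\<in>A. card ((#) y ` B y))"
    by (rule card_UN_le[OF assms])
  also have "\<dots> = (\<Sum>y\<in>A. card (B y))" by (simp add: card_image)
  finally show ?thesis .
qed

context tournament
begin

text \<open>A homomorphism is determined by the image of the centre and the images of the
  legs.\<close>

lemma card_homs_oriented_spider_le: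
  assumes "as \<noteq> []" and pos: "\<And>i. i < length as \<Longrightarrow> 1 \<le> as ! i"
  shows "card (homs (oriented_spider as r) G)
    \<le> (\<Sum>x\<in>pverts G. \<Prod>i<length as. card (leg_walks (parcs G) as r i x))"
proof -
  let ?L = "\<lambda>x. PiE {..<length as} (\<lambda>i. leg_walks (parcs G) as r i x)"
  define \<Phi> where "\<Phi> f = (f Centre, restrict (\<lambda>i. map (\<lambda>j. f (path_vertex i (Suc j))) [0..<as ! i]) {..<length as})"
    for f :: "spider_vertex \<Rightarrow> 'a"
  have V: "pverts (oriented_spider as r) = pverts (spider as)" by (simp add: oriented_spider_def)
  have C: "Centre \<in> pverts (spider as)"
  proof -
    have "Centre = path_vertex 0 0" "0 < length as" using assms by (simp_all add: path_vertex_def)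
    then show ?thesis unfolding spider_def by auto
  qed
  have "\<Phi> ` homs (oriented_spider as r) G \<subseteq> Sigma (pverts G) ?L"
  proof (rule image_subsetI)
    fix f assume f: "f \<in> homs (oriented_spider as r) G"
    then have "f Centre \<in> pverts G" using C V by (auto simp: homs_def)
    then show "\<Phi> f \<in> Sigma (pverts G) ?L"
      using map_in_leg_walks[OF f] pos by (auto simp: \<Phi>_def)
  qed
  moreover have "inj_on \<Phi> (homs (oriented_spider as r) G)"
  proof (rule inj_onI)
    fix f g assume fg: "f \<in> homs (oriented_spider as r) G" "g \<in> homs (oriented_spider as r) G"
      and eq: "\<Phi> f = \<Phi> g"
    have leg: "f (path_vertex i (Suc j)) = g (path_vertex i (Suc j))" if "i < length as" "j < as ! i" for i j
    proof -
      have "map (\<lambda>j. f (path_vertex i (Suc j))) [0..<as ! i] = map (\<lambda>j. g (path_vertex i (Suc j))) [0..<as ! i]"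
        using arg_cong[OF eq, of "\<lambda>p. snd p i"] that by (simp add: \<Phi>_def)
      then show ?thesis using that by simp
    qed
    show "f = g"
    proof (rule PiE_ext[of _ "pverts (spider as)" "\<lambda>_. pverts G"])
      fix v assume "v \<in> pverts (spider as)"
      then obtain i j where v: "v = path_vertex i j" "i < length as" "j \<le> as ! i" by (auto simp: spider_def)
      show "f v = g v"
        using eq leg[of i "j - 1"] v by (cases j) (auto simp: \<Phi>_def path_vertex_def)
    qed (use fg V in \<open>auto simp: homs_def\<close>)
  qed
  moreover have "finite (Sigma (pverts G) ?L)"
    using pair_finite_verts finite_leg_walks[OF pair_finite_arcs]
    by (intro finite_SigmaI finite_PiE) auto
  ultimately have "card (homs (oriented_spider as r) G) \<le> card (Sigma (pverts G) ?L)"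
    using card_inj_on_le by blast
  also have "\<dots> = (\<Sum>x\<in>pverts G. card (?L x))"
    using pair_finite_verts finite_leg_walks[OF pair_finite_arcs]
    by (intro card_SigmaI) (auto intro!: finite_PiE)
  finally show ?thesis by (simp add: card_PiE)
qed

definition arc_sign :: "'a \<Rightarrow> 'a \<Rightarrow> real" where
  "arc_sign x y = (if (x, y) \<in> parcs G then 1 else if (y, x) \<in> parcs G then -1 else 0)"

lemma arc_sign_skew: "arc_sign x y = - arc_sign y x"
  using asym_arcs by (auto simp: arc_sign_def dest: asymD)

lemma abs_arc_sign: "\<bar>arc_sign x y\<bar> \<le> 1"
  by (simp add: arc_sign_def)

text \<open>Each arc indicator is at most \<open>(1 + arc_sign x y) / 2\<close>, so a sum over
  out-neighbours is at most \<open>n / 2\<close> times \<open>J + S\<close>, and a sum over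
  in-neighbours at most \<open>n / 2\<close> times \<open>J - S\<close>.\<close>

lemma hom_density_oriented_spider_le:
  assumes "as \<noteq> []" and pos: "\<And>i. i < length as \<Longrightarrow> 1 \<le> as ! i" and "pverts G \<noteq> {}"
  shows "hom_density (oriented_spider as r) G \<le> (1 / 2) ^ card (parcs (oriented_spider as r)) *
    skew_kernel.mean (pverts G) (\<lambda>x. \<Prod>i<length as.
      if i = r then skew_kernel.rev_u (pverts G) arc_sign (as ! i - 1) x else skew_kernel.u (pverts G) arc_sign (as ! i) x)"
proof -
  interpret skew_kernel "pverts G" arc_sign
    using pair_finite_verts assms(3) arc_sign_skew abs_arc_sign by unfold_locales
  define n where "n = real (card (pverts G))"
  have n: "0 < n" using card_V_pos by (simp add: n_def)
  have arc_sum: "(\<Sum>y\<in>{y. P y}. h y) \<le> n * mean (\<lambda>y. (1 + \<epsilon> y) / 2 * h y)"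
    if P: "\<And>y. P y \<Longrightarrow> y \<in> pverts G \<and> \<epsilon> y = 1" and \<epsilon>: "\<And>y. -1 \<le> \<epsilon> y" and h: "\<And>y. 0 \<le> h y"
    for P \<epsilon> and h :: "'a \<Rightarrow> real"
  proof -
    have "(\<Sum>y\<in>{y. P y}. h y) = (\<Sum>y\<in>{y. P y}. (1 + \<epsilon> y) / 2 * h y)"
      by (rule sum.cong) (auto dest: P)
    also have "\<dots> \<le> (\<Sum>y\<in>pverts G. (1 + \<epsilon> y) / 2 * h y)"
      using \<epsilon> h P pair_finite_verts by (intro sum_mono2) (auto simp: add_nonneg_nonneg intro!: mult_nonneg_nonneg, smt (verit))
    also have "\<dots> = n * mean (\<lambda>y. (1 + \<epsilon> y) / 2 * h y)"
      using n by (simp add: mean_def n_def[symmetric])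
    finally show ?thesis .
  qed
  have sgn1: "-1 \<le> arc_sign x y" "-1 \<le> - arc_sign x y" for x y
    using abs_arc_sign[of x y] by linarith+
  have walks: "real (card (walks (parcs G) k x)) \<le> (n / 2) ^ k * u k x" for k x
  proof (induction k arbitrary: x)
    case (Suc k)
    have "{y. (x, y) \<in> parcs G} \<subseteq> pverts G" by (auto dest: in_arcsD2)
    then have fin: "finite {y. (x, y) \<in> parcs G}" using pair_finite_verts by (rule finite_subset)
    have "real (card (walks (parcs G) (Suc k) x)) \<le> (\<Sum>y\<in>{y. (x, y) \<in> parcs G}. real (card (walks (parcs G) k y)))"
      using card_Cons_UNION_le[OF fin, of "walks (parcs G) k"] by (simp flip: of_nat_sum)
    also have "\<dots> \<le> (\<Sum>y\<in>{y. (x, y) \<in> parcs G}. (n / 2) ^ k * u k y)"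
      by (intro sum_mono Suc.IH)
    also have "\<dots> \<le> n * mean (\<lambda>y. (1 + arc_sign x y) / 2 * ((n / 2) ^ k * u k y))"
    proof (rule arc_sum)
      show "y \<in> pverts G \<and> arc_sign x y = 1" if "(x, y) \<in> parcs G" for y
        using that by (auto simp: arc_sign_def dest: in_arcsD2)
    qed (use n u_nonneg sgn1 in simp_all)
    also have "\<dots> = n * mean (\<lambda>y. (n / 2) ^ k / 2 * (u k y + arc_sign x y * u k y))"
      by (simp add: algebra_simps add_divide_distrib)
    also have "\<dots> = (n / 2) ^ Suc k * u (Suc k) x"
      by (simp only: mean_mult_left mean_add u.simps S_def) (simp add: algebra_simps)
    finally show ?case .
  qed simp
  have rev_walks: "real (card (rev_walks (parcs G) k x)) \<le> (n / 2) ^ Suc k * rev_u k x" for k x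
  proof -
    have "{y. (y, x) \<in> parcs G} \<subseteq> pverts G" by (auto dest: in_arcsD1)
    then have fin: "finite {y. (y, x) \<in> parcs G}" using pair_finite_verts by (rule finite_subset)
    have "real (card (rev_walks (parcs G) k x)) \<le> (\<Sum>y\<in>{y. (y, x) \<in> parcs G}. real (card (walks (parcs G) k y)))"
      using card_Cons_UNION_le[OF fin, of "walks (parcs G) k"] by (simp add: rev_walks_def flip: of_nat_sum)
    also have "\<dots> \<le> (\<Sum>y\<in>{y. (y, x) \<in> parcs G}. (n / 2) ^ k * u k y)"
      by (intro sum_mono walks)
    also have "\<dots> \<le> n * mean (\<lambda>y. (1 + - arc_sign x y) / 2 * ((n / 2) ^ k * u k y))"
    proof (rule arc_sum)
      show "y \<in> pverts G \<and> - arc_sign x y = 1" if "(y, x) \<in> parcs G" for y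
        using that by (auto simp: arc_sign_skew[of x y] arc_sign_def[of y x] dest: in_arcsD1)
    qed (use n u_nonneg sgn1 in simp_all)
    also have "\<dots> = n * mean (\<lambda>y. (n / 2) ^ k / 2 * (u k y - arc_sign x y * u k y))"
      by (simp add: algebra_simps diff_divide_distrib)
    also have "\<dots> = (n / 2) ^ Suc k * rev_u k x"
      by (simp only: mean_mult_left mean_diff rev_u_def S_def e_def) (simp add: algebra_simps)
    finally show ?thesis .
  qed
  define h where "h i = (if i = r then rev_u (as ! i - 1) else u (as ! i))" for i
  have leg: "real (card (leg_walks (parcs G) as r i x)) \<le> (n / 2) ^ (as ! i) * h i x" if "i < length as" for i x
  proof (cases "i = r")
    case True
    have "Suc (as ! i - 1) = as ! i" using pos[OF that] by simp
    then show ?thesis using rev_walks[of "as ! i - 1" x] True by (simp add: leg_walks_def h_def)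
  qed (use walks in \<open>simp add: leg_walks_def h_def\<close>)
  let ?s = "\<Sum>i<length as. as ! i"
  have "real (card (homs (oriented_spider as r) G))
      \<le> (\<Sum>x\<in>pverts G. \<Prod>i<length as. real (card (leg_walks (parcs G) as r i x)))"
    using card_homs_oriented_spider_le[OF assms(1) pos, of r] by (simp flip: of_nat_prod of_nat_sum)
  also have "\<dots> \<le> (\<Sum>x\<in>pverts G. \<Prod>i<length as. (n / 2) ^ (as ! i) * h i x)"
    using leg by (intro sum_mono prod_mono) auto
  also have "\<dots> = (n / 2) ^ ?s * (n * mean (\<lambda>x. \<Prod>i<length as. h i x))"
    using n by (simp add: prod.distrib power_sum sum_distrib_left[symmetric] mean_def n_def[symmetric])
  finally have homs: "real (card (homs (oriented_spider as r) G)) \<le> \<dots>" .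
  have "hom_density (oriented_spider as r) G = real (card (homs (oriented_spider as r) G)) / n ^ Suc ?s"
    using card_pverts_spider[OF assms(1)] by (simp add: hom_density_def n_def oriented_spider_def)
  also have "\<dots> \<le> (n / 2) ^ ?s * (n * mean (\<lambda>x. \<Prod>i<length as. h i x)) / n ^ Suc ?s"
    using homs n by (intro divide_right_mono) auto
  also have "\<dots> = (1 / 2) ^ ?s * mean (\<lambda>x. \<Prod>i<length as. h i x)"
    using n by (simp add: power_divide)
  finally show ?thesis
    by (simp add: card_parcs_oriented_spider h_def if_distrib[of "\<lambda>g. g _"] cong: if_cong)
qed

end

text \<open>The reversed leg is one of two equally long legs if there are such legs, and the longest
  leg otherwise.\<close>

theorem theorem1p7:
  fixes a b c :: nat
  assumes "a \<ge> 1" and "b \<ge> 1" and "c \<ge> 1"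
  shows "\<exists>H. is_orientation (spider [a, b, c]) H \<and> tournament_anti_Sidorenko H"
proof -
  obtain a' b' c' where abc: "a = Suc a'" "b = Suc b'" "c = Suc c'"
    using assms by (metis Suc_le_D One_nat_def)
  define good where "good x y z \<longleftrightarrow> x = z \<or> y = z \<or> (x \<noteq> y \<and> x < z \<and> y < z)" for x y z :: nat
  obtain r :: nat where r: "(r = 0 \<and> good b' c' a') \<or> (r = 1 \<and> good a' c' b') \<or> (r = 2 \<and> good a' b' c')"
    unfolding good_def by (metis linorder_neqE_nat order_less_trans)
  have "hom_density (oriented_spider [a, b, c] r) T \<le> (1 / 2) ^ card (parcs (oriented_spider [a, b, c] r))"
    if "tournament T" for T :: "nat pair_pre_digraph"
  proof (cases "pverts T = {}")
    case True
    then show ?thesis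
      using card_pverts_spider[of "[a, b, c]"] by (simp add: hom_density_def oriented_spider_def)
  next
    case False
    interpret T: tournament T by (rule that)
    interpret skew_kernel "pverts T" T.arc_sign
      using T.pair_finite_verts False T.arc_sign_skew T.abs_arc_sign by unfold_locales
    let ?m = "mean (\<lambda>x. \<Prod>i<length [a, b, c]. if i = r then rev_u ([a, b, c] ! i - 1) x else u ([a, b, c] ! i) x)"
    have "?m \<le> 1"
      using r
    proof (elim disjE conjE)
      assume r0: "r = 0" and good: "good b' c' a'"
      have "?m = spider_density b' c' a'"
        unfolding spider_density_def
        by (rule mean_cong) (simp add: abc r0 mult_ac)
      then show ?thesis using spider_density_le_1 good unfolding good_def by simp
    next
      assume r1: "r = 1" and good: "good a' c' b'"
      have "?m = spider_density a' c' b'"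
        unfolding spider_density_def
        by (rule mean_cong) (simp add: abc r1 mult_ac)
      then show ?thesis using spider_density_le_1 good unfolding good_def by simp
    next
      assume r2: "r = 2" and good: "good a' b' c'"
      have "?m = spider_density a' b' c'"
        unfolding spider_density_def
        by (rule mean_cong) (simp add: abc r2 mult_ac)
      then show ?thesis using spider_density_le_1 good unfolding good_def by simp
    qed
    then have "(1 / 2) ^ card (parcs (oriented_spider [a, b, c] r)) * ?m
        \<le> (1 / 2) ^ card (parcs (oriented_spider [a, b, c] r))"
      by (simp add: mult_left_le)
    moreover have "hom_density (oriented_spider [a, b, c] r) T
        \<le> (1 / 2) ^ card (parcs (oriented_spider [a, b, c] r)) * ?m"
    proof (rule T.hom_density_oriented_spider_le)
      show "1 \<le> [a, b, c] ! i" if "i < length [a, b, c]" for i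
        using that assms by (auto simp: less_Suc_eq numeral_3_eq_3)
    qed (use False in simp_all)
    ultimately show ?thesis by (rule order_trans[rotated])
  qed
  then show ?thesis
    using is_orientation_oriented_spider oriented_graph_oriented_spider
    unfolding tournament_anti_Sidorenko_def by blast
qed

end
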